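(* Let $G$ be an acylindrically hyperbolic group. Suppose that $G=G_1\cdots G_n$ for some subgroups $G_1,\dots,G_n$ of $G$ (i.e., every element of $G$ is of the form $g_1\cdots g_n$ with $g_i\in G_i$ for all $i$). Then $G_i$ is acylindrically hyperbolic for at least one $i\in\{1,\dots,n\}$.
   Context: All actions on metric spaces are by isometries. A metric space is hyperbolic if it is geodesic and for some $\delta\ge0$ every side of every geodesic triangle lies in the union of the $\delta$-neighborhoods of the other two sides; it is not assumed proper. An action of $G$ on $(S,d)$ is acylindrical if for every $\varepsilon>0$ there exist $R,N>0$ such that for all $x,y\in S$ with $d(x,y)\ge R$ there are at most $N$ elements $g\in G$ with $d(x,gx)\le\varepsilon$ and $d(y,gy)\le\varepsilon$. An action of $G$ on a hyperbolic space $S$ is elementary if the limit set of $G$ on the Gromov boundary $\partial S$ (the set of accumulation points in $\partial S$ of any orbit) has at most $2$ points, and non-elementary otherwise. A group is acylindrically hyperbolic if it admits a non-elementary acylindrical action on a hyperbolic space. *)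

theory Defs
  imports "HOL-Analysis.Analysis" "HOL-Algebra.Group_Action"
begin

section \<open>Hyperbolic metric spaces\<close>

text \<open>Metric spaces are given by a carrier \<open>S\<close> and a distance \<open>d\<close>, as in the locale
  \<^locale>\<open>Metric_space\<close>.\<close>

definition geodesic_segment :: "'s set \<Rightarrow> ('s \<Rightarrow> 's \<Rightarrow> real) \<Rightarrow> 's \<Rightarrow> 's \<Rightarrow> 's set \<Rightarrow> bool" where
  "geodesic_segment S d x y A \<longleftrightarrow>
     (\<exists>c :: real \<Rightarrow> 's. c ` {0..d x y} = A \<and> A \<subseteq> S \<and> c 0 = x \<and> c (d x y) = y \<and>
        (\<forall>s\<in>{0..d x y}. \<forall>t\<in>{0..d x y}. d (c s) (c t) = \<bar>s - t\<bar>))"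

definition geodesic_space :: "'s set \<Rightarrow> ('s \<Rightarrow> 's \<Rightarrow> real) \<Rightarrow> bool" where
  "geodesic_space S d \<longleftrightarrow> Metric_space S d \<and> (\<forall>x\<in>S. \<forall>y\<in>S. \<exists>A. geodesic_segment S d x y A)"

definition nbhd :: "'s set \<Rightarrow> ('s \<Rightarrow> 's \<Rightarrow> real) \<Rightarrow> real \<Rightarrow> 's set \<Rightarrow> 's set" where
  "nbhd S d \<delta> A = {p \<in> S. \<exists>q\<in>A. d p q \<le> \<delta>}"

definition hyperbolic_space :: "'s set \<Rightarrow> ('s \<Rightarrow> 's \<Rightarrow> real) \<Rightarrow> bool" where
  "hyperbolic_space S d \<longleftrightarrow> geodesic_space S d \<and>
     (\<exists>\<delta>\<ge>0. \<forall>x\<in>S. \<forall>y\<in>S. \<forall>z\<in>S. \<forall>A B C.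
        geodesic_segment S d x y A \<and> geodesic_segment S d y z B \<and> geodesic_segment S d z x C \<longrightarrow>
        A \<subseteq> nbhd S d \<delta> B \<union> nbhd S d \<delta> C \<and>
        B \<subseteq> nbhd S d \<delta> C \<union> nbhd S d \<delta> A \<and>
        C \<subseteq> nbhd S d \<delta> A \<union> nbhd S d \<delta> B)"

section \<open>The Gromov boundary\<close>

text \<open>Since \<open>S\<close> need not be proper, \<open>\<partial>S\<close> is the set of equivalence classes of sequences
  converging at infinity, and a sequence of points of \<open>S\<close> converges to \<open>\<xi> \<in> \<partial>S\<close> iff it belongs
  to the class \<open>\<xi>\<close>.  The conditions below do not depend on the base point \<open>w\<close>, because
  changing \<open>w\<close> to \<open>v\<close> changes the Gromov product by at most \<open>d w v\<close>.\<close>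

definition gromov_product :: "('s \<Rightarrow> 's \<Rightarrow> real) \<Rightarrow> 's \<Rightarrow> 's \<Rightarrow> 's \<Rightarrow> real" where
  "gromov_product d w x y = (d x w + d y w - d x y) / 2"

definition gromov_joint :: "'s set \<Rightarrow> ('s \<Rightarrow> 's \<Rightarrow> real) \<Rightarrow> (nat \<Rightarrow> 's) \<Rightarrow> (nat \<Rightarrow> 's) \<Rightarrow> bool" where
  "gromov_joint S d x y \<longleftrightarrow>
     (\<forall>w\<in>S. filterlim (\<lambda>(i, j). gromov_product d w (x i) (y j)) at_top
              (sequentially \<times>\<^sub>F sequentially))"

definition converging_at_infinity :: "'s set \<Rightarrow> ('s \<Rightarrow> 's \<Rightarrow> real) \<Rightarrow> (nat \<Rightarrow> 's) set" where
  "converging_at_infinity S d = {x. range x \<subseteq> S \<and> gromov_joint S d x x}"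

definition gromov_boundary :: "'s set \<Rightarrow> ('s \<Rightarrow> 's \<Rightarrow> real) \<Rightarrow> (nat \<Rightarrow> 's) set set" where
  "gromov_boundary S d = converging_at_infinity S d //
     {(x, y). x \<in> converging_at_infinity S d \<and> y \<in> converging_at_infinity S d \<and> gromov_joint S d x y}"

definition accumulation_points_at_infinity ::
  "'s set \<Rightarrow> ('s \<Rightarrow> 's \<Rightarrow> real) \<Rightarrow> 's set \<Rightarrow> (nat \<Rightarrow> 's) set set" where
  "accumulation_points_at_infinity S d A = {\<xi> \<in> gromov_boundary S d. \<exists>x\<in>\<xi>. range x \<subseteq> A}"

section \<open>Acylindrically hyperbolic groups\<close>

definition isometric_action ::
  "('a, 'm) monoid_scheme \<Rightarrow> 's set \<Rightarrow> ('s \<Rightarrow> 's \<Rightarrow> real) \<Rightarrow> ('a \<Rightarrow> 's \<Rightarrow> 's) \<Rightarrow> bool" where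
  "isometric_action G S d \<phi> \<longleftrightarrow> Metric_space S d \<and> group_action G S \<phi> \<and>
     (\<forall>g\<in>carrier G. \<forall>x\<in>S. \<forall>y\<in>S. d (\<phi> g x) (\<phi> g y) = d x y)"

definition acylindrical_action ::
  "('a, 'm) monoid_scheme \<Rightarrow> 's set \<Rightarrow> ('s \<Rightarrow> 's \<Rightarrow> real) \<Rightarrow> ('a \<Rightarrow> 's \<Rightarrow> 's) \<Rightarrow> bool" where
  "acylindrical_action G S d \<phi> \<longleftrightarrow> isometric_action G S d \<phi> \<and>
     (\<forall>\<epsilon>>0. \<exists>R>0. \<exists>N::nat. N > 0 \<and>
        (\<forall>x\<in>S. \<forall>y\<in>S. d x y \<ge> R \<longrightarrow>
           finite {g \<in> carrier G. d x (\<phi> g x) \<le> \<epsilon> \<and> d y (\<phi> g y) \<le> \<epsilon>} \<and>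
           card {g \<in> carrier G. d x (\<phi> g x) \<le> \<epsilon> \<and> d y (\<phi> g y) \<le> \<epsilon>} \<le> N))"

text \<open>All orbits of an isometric action have the same accumulation points at infinity, so the
  union below is the set of accumulation points of any single orbit.\<close>

definition limit_set ::
  "('a, 'm) monoid_scheme \<Rightarrow> 's set \<Rightarrow> ('s \<Rightarrow> 's \<Rightarrow> real) \<Rightarrow> ('a \<Rightarrow> 's \<Rightarrow> 's) \<Rightarrow> (nat \<Rightarrow> 's) set set" where
  "limit_set G S d \<phi> = (\<Union>s\<in>S. accumulation_points_at_infinity S d (orbit G \<phi> s))"

definition elementary_action ::
  "('a, 'm) monoid_scheme \<Rightarrow> 's set \<Rightarrow> ('s \<Rightarrow> 's \<Rightarrow> real) \<Rightarrow> ('a \<Rightarrow> 's \<Rightarrow> 's) \<Rightarrow> bool" where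
  "elementary_action G S d \<phi> \<longleftrightarrow> finite (limit_set G S d \<phi>) \<and> card (limit_set G S d \<phi>) \<le> 2"

text \<open>HOL cannot quantify over types inside a formula, so the type \<open>'s\<close> containing the points
  of the space \<open>S\<close> is an explicit parameter, playing the role of a universe; \<open>S\<close> itself is an
  arbitrary subset of \<open>'s\<close> with an arbitrary metric.  The choice of \<open>'s\<close> matters only through
  its cardinality: closing an orbit under the action and under a choice of geodesics gives an
  invariant geodesic subspace of cardinality at most \<open>max |G| 2\<^sup>\<aleph>\<^sup>0\<close>, on which the
  action is still acylindrical and non-elementary.\<close>

definition acylindrically_hyperbolic :: "'s itself \<Rightarrow> ('a, 'm) monoid_scheme \<Rightarrow> bool" where
  "acylindrically_hyperbolic (T :: 's itself) G \<longleftrightarrow>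
     (\<exists>(S :: 's set) d \<phi>. hyperbolic_space S d \<and> acylindrical_action G S d \<phi> \<and>
        \<not> elementary_action G S d \<phi>)"

end

theory Submission
  imports Defs "HOL-Algebra.Generated_Groups"
begin

text \<open>Let \<open>G\<close> act acylindrically and non-elementarily on a hyperbolic space, and suppose that every
  \<open>G\<^sub>i\<close> acts elementarily.  An unbounded \<open>G\<^sub>i\<close> contains a loxodromic element (an acylindrical action
  without loxodromic elements has bounded orbits), and since its limit set has at most two points
  its orbit stays near the axis of that element.  Pick \<open>t \<in> G\<close> loxodromic and \<open>g \<in> G\<close> that does not
  commensurate \<open>\<langle>t\<rangle>\<close>, and let \<open>u = t\<^sup>M g\<close> with \<open>M\<close> large.  If \<open>u\<^sup>2\<^sup>n = g\<^sub>1 \<cdots> g\<^sub>n\<close>,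
  then by hyperbolicity and the pigeonhole principle two consecutive translates of the
  \<open>t\<close>-segment of length \<open>M\<close> on the path of \<open>u\<^sup>2\<^sup>n\<close> lie near one translate of the orbit of a single \<open>G\<^sub>i\<close>.
  This orbit is not bounded because \<open>M\<close> is large; and if it lies near an axis, acylindricity forces
  that axis to be parallel to both translates of the axis of \<open>t\<close>, so that \<open>g\<close> commensurates \<open>\<langle>t\<rangle>\<close>
  after all.\<close>

section \<open>Gromov products and the four-point inequality\<close>

text \<open>The order of the constants shapes the proof. The polygon argument yields a tolerance
  \<open>K\<close> that depends on the quasi-geodesic constant of \<open>u\<close>, whereas
  \<open>M\<close> must be large compared with \<open>K\<close>. So \<open>u\<close> needs a
  constant that is the same for all large \<open>M\<close>. It comes from a bound, independent of
  the exponents, on how far the ray of \<open>inv t\<close> and the \<open>g\<close>-translate of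
  the ray of \<open>t\<close> run together.

  The exponent \<open>2n\<close> serves the pigeonhole: the \<open>n + 1\<close> even powers of
  \<open>u\<close> meet \<open>n\<close> factors, and two of them at one factor are at least two
  steps apart, so they enclose two full segments. One segment would only make \<open>t\<close>
  commensurable with a conjugate of the loxodromic \<open>s\<close> of that factor; comparing two
  adjacent ones eliminates \<open>s\<close> and leaves a relation between \<open>g\<close> and
  \<open>t\<close>.

  The argument is carried out in the group, with the pseudometric pulled back from an orbit and with
  Gromov products in place of geodesics. Points off the orbit matter only for finding loxodromic
  elements, where acylindricity is applied deep inside a segment.\<close>

locale gromov_hyperbolic =
  fixes M :: "'s set" and d :: "'s \<Rightarrow> 's \<Rightarrow> real" and \<delta> :: real
  assumes nonneg: "0 \<le> d x y"
    and commute: "d x y = d y x"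
    and dist_self: "x \<in> M \<Longrightarrow> d x x = 0"
    and triangle: "\<lbrakk>x \<in> M; y \<in> M; z \<in> M\<rbrakk> \<Longrightarrow> d x z \<le> d x y + d y z"
    and delta_nonneg: "0 \<le> \<delta>"
    and four_point: "\<lbrakk>w \<in> M; x \<in> M; y \<in> M; z \<in> M\<rbrakk> \<Longrightarrow>
      min (gromov_product d w x y) (gromov_product d w y z) - \<delta> \<le> gromov_product d w x z"
begin

abbreviation gp :: "'s \<Rightarrow> 's \<Rightarrow> 's \<Rightarrow> real" where "gp \<equiv> gromov_product d"

lemma gp_double: "2 * gp w x y = d x w + d y w - d x y"
  by (simp add: gromov_product_def)

lemma gp_commute: "gp w x y = gp w y x"
  using gp_double[of w x y] gp_double[of w y x] commute[of x y] by linarith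

lemma gp_nonneg: "\<lbrakk>w \<in> M; x \<in> M; y \<in> M\<rbrakk> \<Longrightarrow> 0 \<le> gp w x y"
  using triangle[of x w y] commute[of w y] by (simp add: gromov_product_def)

lemma gp_le_dist: "\<lbrakk>w \<in> M; x \<in> M; y \<in> M\<rbrakk> \<Longrightarrow> gp w x y \<le> d x w"
  using triangle[of w x y] commute[of w y] commute[of w x] triangle[of y x w] commute[of x y]
  by (simp add: gromov_product_def)

lemma gp_self: "x \<in> M \<Longrightarrow> gp w x x = d x w"
  by (simp add: gromov_product_def dist_self)

lemma gp_base: "\<lbrakk>w \<in> M; y \<in> M\<rbrakk> \<Longrightarrow> gp w w y = 0"
  by (simp add: gromov_product_def dist_self commute)

text \<open>In the comparison tripod of \<open>a\<close>, \<open>b\<close>, \<open>c\<close> the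
  legs at \<open>a\<close> and \<open>b\<close> make up the side between them. The identity turns a
  small product at \<open>b\<close> into a large product at \<open>a\<close>, which is the form that
  \<open>four_point\<close> can use.\<close>

lemma gp_add: "gp a b c + gp b a c = d a b"
  by (simp add: gromov_product_def commute field_simps)

lemma gp_change:
  assumes "w \<in> M" "x \<in> M" "x' \<in> M" "y \<in> M"
  shows "gp w x' y \<le> gp w x y + d x x'"
  using triangle[of x' x w] triangle[of x x' y] commute[of x x'] assms
    gp_double[of w x' y] gp_double[of w x y] by linarith

lemma gp_change_base:
  assumes "w \<in> M" "w' \<in> M" "x \<in> M" "y \<in> M"
  shows "gp w' x y \<le> gp w x y + d w w'"
  using triangle[of x w w'] triangle[of y w w'] assms
    gp_double[of w' x y] gp_double[of w x y] by linarith

text \<open>A bound on \<open>gp u x y\<close> stands for "\<open>u\<close> lies near a geodesic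
  from \<open>x\<close> to \<open>y\<close>". Seen from \<open>x\<close>, both \<open>u\<close> and
  \<open>v\<close> then have an almost maximal product with \<open>y\<close>, and
  \<open>four_point\<close> passes this on to \<open>gp x u v\<close>.\<close>

lemma between_close:
  assumes "x \<in> M" "y \<in> M" "u \<in> M" "v \<in> M"
    and u: "gp u x y \<le> K" and v: "gp v x y \<le> K"
  shows "d u v \<le> \<bar>d x u - d x v\<bar> + 2 * K + 2 * \<delta>"
proof -
  have "gp x u y \<ge> d x u - K" using gp_add[of x u y] u by linarith
  moreover have "gp x y v \<ge> d x v - K" using gp_add[of x v y] v gp_commute[of x y v] by linarith
  moreover have "min (gp x u y) (gp x y v) - \<delta> \<le> gp x u v"
    using four_point assms by blast
  ultimately have "gp x u v \<ge> min (d x u) (d x v) - K - \<delta>" by linarith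
  then show ?thesis
    by (simp add: gromov_product_def commute[of u x] commute[of v x])
qed

text \<open>By \<open>four_point\<close> at \<open>z\<close>, the point \<open>x\<close> is nearly
  opposite to \<open>v\<close> or to \<open>v'\<close>. The triangle inequality then exchanges that
  point for \<open>y\<close>, at the cost of its own product.\<close>

lemma between_trans:
  assumes "x \<in> M" "y \<in> M" "z \<in> M" "v \<in> M" "v' \<in> M"
    and v: "gp v x y \<le> K" and v': "gp v' x y \<le> K" and z: "gp z v v' \<le> L"
  shows "gp z x y \<le> K + L + \<delta>"
proof -
  have step: "gp z x y \<le> gp z x a + gp a x y" if "a \<in> M" for a
    using triangle[of y a z] commute[of a z] commute[of y a] that assms commute[of x a]
    by (simp add: gromov_product_def field_simps)
  have "min (gp z v x) (gp z x v') - \<delta> \<le> L"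
    using four_point[of z v x v'] assms by linarith
  then consider "gp z x v \<le> L + \<delta>" | "gp z x v' \<le> L + \<delta>"
    using gp_commute[of z v x] by linarith
  then show ?thesis
    by cases (use step[of v] step[of v'] assms in linarith)+
qed

text \<open>Each induction step splits off the last edge with one use of \<open>four_point\<close>.
  The loss is linear in \<open>n\<close>, which is harmless because \<open>n\<close> is the fixed
  number of factors.\<close>

lemma polygon:
  assumes "n \<ge> 1" "\<And>i. i \<le> n \<Longrightarrow> p i \<in> M" "z \<in> M" "gp z (p 0) (p n) \<le> c"
  shows "\<exists>i<n. gp z (p i) (p (Suc i)) \<le> c + real n * \<delta>"
  using assms
proof (induction n arbitrary: c rule: nat_induct_at_least)
  case base
  then show ?case using delta_nonneg by auto
next
  case (Suc n)
  have "min (gp z (p 0) (p n)) (gp z (p n) (p (Suc n))) - \<delta> \<le> c"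
    using four_point[of z "p 0" "p n" "p (Suc n)"] Suc.prems by force
  then consider "gp z (p 0) (p n) \<le> c + \<delta>" | "gp z (p n) (p (Suc n)) \<le> c + \<delta>"
    by linarith
  then show ?case
  proof cases
    case 1
    then obtain i where "i < n" "gp z (p i) (p (Suc i)) \<le> c + \<delta> + real n * \<delta>"
      using Suc.IH[of "c + \<delta>"] Suc.prems by auto
    then show ?thesis by (intro exI[of _ i]) (auto simp: algebra_simps)
  next
    case 2
    have "0 \<le> real n * \<delta>" using delta_nonneg by simp
    with 2 have "gp z (p n) (p (Suc n)) \<le> c + real (Suc n) * \<delta>"
      by (simp add: algebra_simps)
    then show ?thesis by (intro exI[of _ n]) auto
  qed
qed

text \<open>A discrete intermediate value argument: \<open>k\<close> is the last index whose point
  is no farther from \<open>a i\<close> than \<open>z\<close> is. The next point overshoots, so the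
  two distances differ by at most \<open>s\<close>, and \<open>between_close\<close>
  applies.\<close>

lemma line_projection:
  fixes a :: "int \<Rightarrow> 's"
  assumes "i \<le> j" "\<And>k. a k \<in> M" "z \<in> M"
    and line: "\<And>k. \<lbrakk>i \<le> k; k \<le> j\<rbrakk> \<Longrightarrow> gp (a k) (a i) (a j) \<le> C"
    and step: "\<And>k. d (a k) (a (k + 1)) \<le> s"
    and z: "gp z (a i) (a j) \<le> K" and K: "0 \<le> K" "0 \<le> C"
  shows "\<exists>k. d z (a k) \<le> s + 2 * (K + C) + 2 * \<delta>"
proof -
  have s: "0 \<le> s" using step nonneg order_trans by blast
  define Q where "Q = {k \<in> {i..j}. d (a i) (a k) \<le> d (a i) z}"
  have "finite Q" unfolding Q_def by (rule finite_subset[of _ "{i..j}"]) auto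
  moreover have "i \<in> Q" using assms by (simp add: Q_def dist_self nonneg)
  ultimately obtain k where k: "k \<in> Q" "\<And>l. l \<in> Q \<Longrightarrow> l \<le> k"
    by (metis Max_ge Max_in empty_iff)
  show ?thesis
  proof (cases "k = j")
    case True
    have "d (a i) (a j) \<le> d (a i) z" using k(1) True by (simp add: Q_def)
    then have "d z (a j) \<le> 2 * K"
      using z by (simp add: gromov_product_def commute[of z])
    then show ?thesis using s K delta_nonneg by (intro exI[of _ j]) (simp add: algebra_simps)
  next
    case False
    then have kj: "i \<le> k" "k + 1 \<le> j" using k(1) by (auto simp: Q_def)
    have "k + 1 \<notin> Q" using k(2)[of "k + 1"] by auto
    then have "d (a i) (a (k + 1)) > d (a i) z" using kj by (auto simp: Q_def)
    then have "\<bar>d (a i) z - d (a i) (a k)\<bar> \<le> s"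
      using k(1) step[of k] triangle[of "a i" "a k" "a (k + 1)"] assms(2) by (simp add: Q_def)
    moreover have "gp (a k) (a i) (a j) \<le> K + C" using line[of k] kj K by simp
    moreover have "gp z (a i) (a j) \<le> K + C" using z K by simp
    ultimately have "d z (a k) \<le> s + 2 * (K + C) + 2 * \<delta>"
      using between_close[of "a i" "a j" z "a k" "K + C"] assms by force
    then show ?thesis by blast
  qed
qed

text \<open>Local-to-global principle. The turn at \<open>x (Suc i)\<close> bounds a minimum of two
  products by \<open>C + \<delta>\<close>. The length of the step, less the inductive bound
  \<open>C + \<delta>\<close>, makes the product towards \<open>x 0\<close> larger than that, so the
  other one is small. The same step length leaves a net progress of at least
  \<open>\<eta>\<close>.\<close>

lemma chain_forward:
  fixes x :: "nat \<Rightarrow> 's"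
  assumes M: "\<And>i. x i \<in> M"
    and turn: "\<And>i. gp (x (Suc i)) (x i) (x (Suc (Suc i))) \<le> C" and "0 \<le> C"
    and step: "\<And>i. d (x i) (x (Suc i)) \<ge> 2 * C + 3 * \<delta> + \<eta>" and "0 < \<eta>"
  shows "gp (x i) (x 0) (x (Suc i)) \<le> C + \<delta> \<and> d (x 0) (x i) \<ge> real i * \<eta>"
proof (induction i)
  case 0
  then show ?case using assms M delta_nonneg by (simp add: gp_base dist_self)
next
  case (Suc i)
  have "gp (x (Suc i)) (x i) (x 0) = d (x i) (x (Suc i)) - gp (x i) (x 0) (x (Suc i))"
    using gp_add[of "x (Suc i)" "x i" "x 0"] commute[of "x i"] gp_commute[of "x i" "x 0"] by simp
  also have "\<dots> > C + \<delta>"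
    using step[of i] Suc delta_nonneg \<open>0 < \<eta>\<close> by simp
  finally have "gp (x (Suc i)) (x i) (x 0) > C + \<delta>" .
  moreover have "min (gp (x (Suc i)) (x i) (x 0)) (gp (x (Suc i)) (x 0) (x (Suc (Suc i)))) - \<delta> \<le> C"
    using four_point[of "x (Suc i)" "x i" "x 0" "x (Suc (Suc i))"] turn[of i] M by force
  ultimately have 1: "gp (x (Suc i)) (x 0) (x (Suc (Suc i))) \<le> C + \<delta>" by linarith
  have "d (x 0) (x (Suc i)) = d (x 0) (x i) + d (x i) (x (Suc i)) - 2 * gp (x i) (x 0) (x (Suc i))"
    using gp_double[of "x i" "x 0" "x (Suc i)"] commute[of "x (Suc i)" "x i"] by linarith
  also have "\<dots> \<ge> real i * \<eta> + \<eta>"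
    using Suc step[of i] delta_nonneg by simp
  finally show ?case using 1 by (simp add: algebra_simps)
qed

text \<open>Compared with \<open>chain_forward\<close> the next vertex is replaced by a distant one.
  The mirrored induction \<open>bw\<close>, run from the end \<open>x m\<close>, shows that
  \<open>x (Suc i)\<close> and \<open>x m\<close> lie in the same direction from \<open>x i\<close>;
  one more \<open>four_point\<close> costs the second \<open>\<delta>\<close>.\<close>

lemma chain:
  fixes x :: "nat \<Rightarrow> 's"
  assumes M: "\<And>i. x i \<in> M"
    and turn: "\<And>i. gp (x (Suc i)) (x i) (x (Suc (Suc i))) \<le> C" and "0 \<le> C"
    and step: "\<And>i. d (x i) (x (Suc i)) \<ge> 2 * C + 3 * \<delta> + \<eta>" and "0 < \<eta>"
    and "i \<le> m"
  shows "gp (x i) (x 0) (x m) \<le> C + 2 * \<delta>"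
proof (cases "i = m")
  case True
  then show ?thesis
    using M gp_base[of "x m" "x 0"] gp_commute[of "x m"] delta_nonneg \<open>0 \<le> C\<close> by simp
next
  case False
  have split: "gp (x k) (x (Suc k)) (x m) = d (x k) (x (Suc k)) - gp (x (Suc k)) (x k) (x m)" for k
    using gp_add[of "x k" "x (Suc k)" "x m"] by simp
  have bw: "gp (x (Suc k)) (x k) (x m) \<le> C + \<delta>" if "Suc k \<le> m" for k
  proof -
    have "k \<le> m - 1" using that by simp
    then show ?thesis
    proof (induction rule: inc_induct)
      case base
      have "Suc (m - 1) = m" using that by simp
      then show ?case
        using M gp_base[of "x m" "x (m - 1)"] gp_commute[of "x m"] delta_nonneg \<open>0 \<le> C\<close> by simp
    next
      case (step k)
      have "gp (x (Suc k)) (x (Suc (Suc k))) (x m) > C + \<delta>"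
        using split[of "Suc k"] step.IH assms(4)[of "Suc k"] delta_nonneg \<open>0 < \<eta>\<close> \<open>0 \<le> C\<close> by linarith
      moreover have "min (gp (x (Suc k)) (x k) (x m)) (gp (x (Suc k)) (x m) (x (Suc (Suc k)))) - \<delta> \<le> C"
        using four_point[of "x (Suc k)" "x k" "x m" "x (Suc (Suc k))"] turn[of k] M by force
      ultimately show ?case using gp_commute[of "x (Suc k)" "x m"] by (auto simp: min_def split: if_splits)
    qed
  qed
  have "gp (x i) (x (Suc i)) (x m) > C + 2 * \<delta>"
    using split[of i] bw[of i] assms(4)[of i] \<open>0 < \<eta>\<close> \<open>0 \<le> C\<close> False \<open>i \<le> m\<close> by simp
  moreover have "gp (x i) (x 0) (x (Suc i)) \<le> C + \<delta>"
    using chain_forward[of x C \<eta>, OF assms(1-5)] by blast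
  moreover have "min (gp (x i) (x 0) (x m)) (gp (x i) (x m) (x (Suc i))) - \<delta> \<le> gp (x i) (x 0) (x (Suc i))"
    using four_point M by blast
  ultimately show ?thesis
    using gp_commute[of "x i" "x m"] by (auto simp: min_def split: if_splits)
qed

end

section \<open>Left-invariant hyperbolic pseudometrics on a group\<close>

lemma (in group) inv_mult_cancel:
  assumes "a \<in> carrier G" "b \<in> carrier G"
  shows "inv a \<otimes> (a \<otimes> b) = b" "a \<otimes> (inv a \<otimes> b) = b"
  using assms by (simp_all flip: m_assoc)

lemma (in group) int_pow_conj:
  assumes "k \<in> carrier G" "s \<in> carrier G"
  shows "(k \<otimes> s \<otimes> inv k) [^] (m::int) = k \<otimes> s [^] m \<otimes> inv k"
proof -
  have nat: "(k \<otimes> s \<otimes> inv k) [^] (m::nat) = k \<otimes> s [^] m \<otimes> inv k" for m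
  proof (induction m)
    case 0
    then show ?case using assms by simp
  next
    case (Suc m)
    have "k \<otimes> s [^] m \<otimes> inv k \<otimes> (k \<otimes> s \<otimes> inv k) = k \<otimes> (s [^] m \<otimes> s) \<otimes> inv k"
      using assms by (simp add: m_assoc inv_mult_cancel)
    with Suc show ?case using assms by simp
  qed
  show ?thesis
  proof (cases m rule: int_cases)
    case (nonneg n)
    then show ?thesis using nat by (simp add: int_pow_int)
  next
    case (neg n)
    have "(k \<otimes> s \<otimes> inv k) [^] m = inv (k \<otimes> s [^] Suc n \<otimes> inv k)"
      using assms by (simp only: neg int_pow_neg_int nat m_closed inv_closed)
    also have "\<dots> = k \<otimes> inv (s [^] Suc n) \<otimes> inv k"
      using assms by (simp add: inv_mult_group m_assoc)
    finally show ?thesis using assms by (simp only: neg int_pow_neg_int)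
  qed
qed

text \<open>The intended \<open>d g h\<close> is the distance between \<open>g x0\<close> and
  \<open>h x0\<close>. Stabilizers may be nontrivial, so distinct elements can have distance
  zero.\<close>

locale hyperbolic_group_metric = group G + gromov_hyperbolic "carrier G" d \<delta>
  for G (structure) and d and \<delta> +
  assumes left_invariant:
    "\<lbrakk>a \<in> carrier G; b \<in> carrier G; c \<in> carrier G\<rbrakk> \<Longrightarrow> d (a \<otimes> b) (a \<otimes> c) = d b c"
begin

definition len :: "'a \<Rightarrow> real" where "len g = d \<one> g"

lemma gp_left_invariant:
  "\<lbrakk>a \<in> carrier G; w \<in> carrier G; x \<in> carrier G; y \<in> carrier G\<rbrakk>
    \<Longrightarrow> gp (a \<otimes> w) (a \<otimes> x) (a \<otimes> y) = gp w x y"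
  by (simp add: gromov_product_def left_invariant)

lemma len_nonneg: "0 \<le> len g"
  by (simp add: len_def nonneg)

lemma dist_mult_right: "\<lbrakk>a \<in> carrier G; b \<in> carrier G\<rbrakk> \<Longrightarrow> d a (a \<otimes> b) = len b"
  using left_invariant[of a \<one> b] by (simp add: len_def)

lemma len_inv: "a \<in> carrier G \<Longrightarrow> len (inv a) = len a"
  using dist_mult_right[of a "inv a"] by (simp add: len_def commute)

lemma len_mult_le: "\<lbrakk>a \<in> carrier G; b \<in> carrier G\<rbrakk> \<Longrightarrow> len (a \<otimes> b) \<le> len a + len b"
  using triangle[of \<one> a "a \<otimes> b"] dist_mult_right[of a b] by (simp add: len_def)

lemma len_mult_ge: "\<lbrakk>a \<in> carrier G; b \<in> carrier G\<rbrakk> \<Longrightarrow> len (a \<otimes> b) \<ge> len a - len b"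
  using len_mult_le[of "a \<otimes> b" "inv b"] by (simp add: m_assoc len_inv)

lemma dist_pow: "t \<in> carrier G \<Longrightarrow> d (t [^] (i::int)) (t [^] (j::int)) = len (t [^] (j - i))"
  using dist_mult_right[of "t [^] i" "t [^] (j - i)"] by (simp flip: int_pow_mult)

lemma gp_pow:
  "t \<in> carrier G \<Longrightarrow>
    gp (t [^] (j::int)) (t [^] (i::int)) (t [^] (k::int)) = gp \<one> (t [^] (i - j)) (t [^] (k - j))"
  using gp_left_invariant[of "t [^] j" \<one> "t [^] (i - j)" "t [^] (k - j)"]
  by (simp flip: int_pow_mult)

lemma len_pow_minus: "t \<in> carrier G \<Longrightarrow> len (t [^] (- k :: int)) = len (t [^] k)"
  by (simp add: int_pow_neg len_inv)

lemma len_pow_abs: "t \<in> carrier G \<Longrightarrow> len (t [^] \<bar>k :: int\<bar>) = len (t [^] k)"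
  by (simp add: abs_if len_pow_minus)

lemma len_pow_le: 
  assumes "t \<in> carrier G"
  shows "len (t [^] (k::int)) \<le> \<bar>real_of_int k\<bar> * len t"
proof -
  have "len (t [^] (n::nat)) \<le> real n * len t" for n
  proof (induction n)
    case 0
    then show ?case by (simp add: len_def dist_self)
  next
    case (Suc n)
    then show ?case
      using len_mult_le[of "t [^] n" t] assms by (simp add: algebra_simps)
  qed
  from this[of "nat \<bar>k\<bar>"] show ?thesis
    using len_pow_abs[of t k] assms by (simp add: pow_nat)
qed

text \<open>The bound \<open>C\<close> says that the powers of \<open>t\<close> run along a quasi-geodesic line; for unbounded
  powers this is equivalent to the usual definition of loxodromic elements.\<close>

definition loxodromic :: "real \<Rightarrow> 'a \<Rightarrow> bool" where
  "loxodromic C t \<longleftrightarrow> t \<in> carrier G \<and> 0 \<le> C \<and>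
     (\<forall>(p::int) (q::int). p \<le> 0 \<longrightarrow> 0 \<le> q \<longrightarrow> gp \<one> (t [^] p) (t [^] q) \<le> C) \<and>
     (\<forall>B. \<exists>q::int. 0 \<le> q \<and> B \<le> len (t [^] q))"

lemma loxodromic_closed [simp]: "loxodromic C t \<Longrightarrow> t \<in> carrier G"
  by (simp add: loxodromic_def)

lemma loxodromic_nonneg: "loxodromic C t \<Longrightarrow> 0 \<le> C"
  by (simp add: loxodromic_def)

lemma loxodromic_between:
  fixes i j k :: int
  assumes "loxodromic C t" "i \<le> j" "j \<le> k"
  shows "gp (t [^] j) (t [^] i) (t [^] k) \<le> C"
  using assms by (simp add: gp_pow loxodromic_def)

lemma loxodromic_superadditive:
  fixes p q :: int
  assumes t: "loxodromic C t" and "0 \<le> p" "0 \<le> q"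
  shows "len (t [^] (p + q)) \<ge> len (t [^] p) + len (t [^] q) - 2 * C"
proof -
  have "gp \<one> (t [^] (- p)) (t [^] q) \<le> C" using assms by (simp add: loxodromic_def)
  moreover have "d (t [^] (- p)) (t [^] q) = len (t [^] (p + q))"
    using dist_pow[of t "-p" q] t by (simp add: add.commute)
  moreover have "d (t [^] (- p)) \<one> = len (t [^] p)"
    using len_pow_minus[of t p] t by (simp add: commute len_def)
  moreover have "d (t [^] q) \<one> = len (t [^] q)" by (simp add: commute len_def)
  ultimately show ?thesis
    using gp_double[of \<one> "t [^] (- p)" "t [^] q"] by linarith
qed

text \<open>On one side of \<open>\<one>\<close> superadditivity makes length a coarse coordinate
  along the axis. It does not see the side: \<open>t [^] m\<close> and \<open>t [^] (- m)\<close>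
  have the same length, hence the condition \<open>sign\<close>.\<close>

lemma loxodromic_diff:
  fixes m m' :: int
  assumes t: "loxodromic C t" and sign: "0 \<le> m \<and> 0 \<le> m' \<or> m \<le> 0 \<and> m' \<le> 0"
  shows "len (t [^] (m - m')) \<le> \<bar>len (t [^] m) - len (t [^] m')\<bar> + 2 * C"
proof -
  have *: "len (t [^] (a - b)) \<le> \<bar>len (t [^] a) - len (t [^] b)\<bar> + 2 * C"
    if "0 \<le> b" "b \<le> a" for a b :: int
    using loxodromic_superadditive[OF t, of b "a - b"] that by simp
  have **: "len (t [^] (a - b)) \<le> \<bar>len (t [^] a) - len (t [^] b)\<bar> + 2 * C"
    if "0 \<le> b" "0 \<le> a" for a b :: int
    using *[of b a] *[of a b] len_pow_minus[of t "a - b"] t that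
    by (cases "b \<le> a") (auto simp: abs_minus_commute)
  show ?thesis
  proof (cases "0 \<le> m \<and> 0 \<le> m'")
    case True
    then show ?thesis using ** by blast
  next
    case False
    then have "len (t [^] (- m - - m')) \<le> \<bar>len (t [^] (- m)) - len (t [^] (- m'))\<bar> + 2 * C"
      using sign by (intro **) auto
    moreover have "- m - - m' = - (m - m')" by simp
    ultimately show ?thesis using t len_pow_minus[of t] by (metis loxodromic_closed)
  qed
qed

text \<open>The definition supplies a single long power; superadditivity spreads its length to all
  exponents of larger absolute value.\<close>

lemma loxodromic_proper:
  assumes t: "loxodromic C t"
  obtains n :: int where "0 \<le> n" "\<And>k. n \<le> \<bar>k\<bar> \<Longrightarrow> B \<le> len (t [^] k)"
proof -
  obtain n :: int where n: "0 \<le> n" "B + 2 * C \<le> len (t [^] n)"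
    using t unfolding loxodromic_def by blast
  have "B \<le> len (t [^] k)" if "n \<le> \<bar>k\<bar>" for k
  proof -
    have "len (t [^] \<bar>k\<bar>) \<ge> len (t [^] n) + len (t [^] (\<bar>k\<bar> - n)) - 2 * C"
      using loxodromic_superadditive[OF t, of n "\<bar>k\<bar> - n"] n that by simp
    then show ?thesis using n(2) len_nonneg[of "t [^] (\<bar>k\<bar> - n)"] len_pow_abs[of t k] t by simp
  qed
  with n(1) that show thesis by blast
qed

lemma loxodromic_pow_neq_one:
  assumes t: "loxodromic C t" and "p \<noteq> 0"
  shows "t [^] (p::int) \<noteq> \<one>"
proof
  assume eq: "t [^] p = \<one>"
  obtain n :: int where n: "0 \<le> n" "\<And>k. n \<le> \<bar>k\<bar> \<Longrightarrow> 1 \<le> len (t [^] k)"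
    using loxodromic_proper[OF t] by blast
  have "n * 1 \<le> n * \<bar>p\<bar>" using \<open>p \<noteq> 0\<close> n(1) by (intro mult_left_mono) auto
  then have "n \<le> \<bar>p * n\<bar>" using n(1) by (simp add: abs_mult mult.commute)
  moreover have "t [^] (p * n) = \<one>"
    using int_pow_pow[of t p n] eq t by simp
  ultimately have "1 \<le> len \<one>" using n(2) by metis
  then show False by (simp add: len_def dist_self)
qed

lemma loxodromic_inv:
  assumes t: "loxodromic C t"
  shows "loxodromic C (inv t)"
proof -
  have "inv t [^] p = t [^] (- p)" for p :: int
    using t by (simp add: int_pow_inv int_pow_neg)
  moreover have "gp \<one> (t [^] (- p)) (t [^] (- q)) \<le> C" if "p \<le> 0" "0 \<le> q" for p q :: int
    using t that gp_commute[of \<one> "t [^] (- p)"] by (simp add: loxodromic_def)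
  ultimately show ?thesis
    using t len_pow_minus[of t] by (simp add: loxodromic_def)
qed

lemma loxodromic_projection:
  fixes i j :: int
  assumes t: "loxodromic C t" and "k \<in> carrier G" "z \<in> carrier G"
    and z: "gp z (k \<otimes> t [^] i) (k \<otimes> t [^] j) \<le> K"
  shows "\<exists>l::int. d z (k \<otimes> t [^] l) \<le> len t + 2 * (K + C) + 2 * \<delta>"
proof -
  have *: "\<exists>l::int. d z (k \<otimes> t [^] l) \<le> len t + 2 * (K + C) + 2 * \<delta>"
    if "i \<le> j" "gp z (k \<otimes> t [^] i) (k \<otimes> t [^] j) \<le> K" for i j :: int
  proof (rule line_projection[of i j "\<lambda>l. k \<otimes> t [^] l"])
    show "gp (k \<otimes> t [^] l) (k \<otimes> t [^] i) (k \<otimes> t [^] j) \<le> C" if "i \<le> l" "l \<le> j" for l :: int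
      using loxodromic_between[OF t that] assms by (simp add: gp_left_invariant)
    show "d (k \<otimes> t [^] l) (k \<otimes> t [^] (l + 1)) \<le> len t" for l :: int
      using dist_pow[of t l "l + 1"] assms by (simp add: left_invariant)
    show "0 \<le> K" using that gp_nonneg[of z "k \<otimes> t [^] i" "k \<otimes> t [^] j"] assms by simp
  qed (use that assms loxodromic_nonneg[OF t] in \<open>simp_all\<close>)
  show ?thesis
  proof (cases "i \<le> j")
    case True
    then show ?thesis using *[of i j] z by blast
  next
    case False
    then show ?thesis
      using *[of j i] z gp_commute[of z "k \<otimes> t [^] i" "k \<otimes> t [^] j"] by simp
  qed
qed

text \<open>By left invariance the path of powers of \<open>u\<close> has the same turn and the same
  step at every vertex, so the chain lemmas apply. The resulting constant depends on the turn and
  \<open>\<delta>\<close> only, not on the length of \<open>u\<close>.\<close>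

lemma loxodromic_local_criterion:
  assumes "u \<in> carrier G" and turn: "gp \<one> (inv u) u \<le> C"
    and long: "2 * C + 3 * \<delta> + \<eta> \<le> len u" and "0 < \<eta>"
  shows "loxodromic (C + 2 * \<delta>) u" and "len (u [^] (m::nat)) \<ge> real m * \<eta>"
proof -
  define x where "x i = u [^] int i" for i
  have C: "0 \<le> C" using gp_nonneg[of \<one> "inv u" u] assms by simp
  have x: "x i \<in> carrier G" for i using assms by (simp add: x_def)
  have t: "gp (x (Suc i)) (x i) (x (Suc (Suc i))) \<le> C" for i
    using gp_pow[of u "int (Suc i)" "int i" "int (Suc (Suc i))"] assms
    by (simp add: x_def int_pow_neg)
  have s: "2 * C + 3 * \<delta> + \<eta> \<le> d (x i) (x (Suc i))" for i
    using dist_pow[of u "int i" "int (Suc i)"] assms by (simp add: x_def)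
  show *: "len (u [^] m) \<ge> real m * \<eta>" for m :: nat
    using chain_forward[of x C \<eta> m, OF x t C s \<open>0 < \<eta>\<close>] by (simp add: x_def len_def int_pow_int)
  have "gp \<one> (u [^] p) (u [^] q) \<le> C + 2 * \<delta>" if "p \<le> 0" "0 \<le> q" for p q :: int
    using chain[of x C \<eta> "nat (- p)" "nat (q - p)", OF x t C s \<open>0 < \<eta>\<close>] that assms
      gp_pow[of u "- p" 0 "q - p"]
    by (simp add: x_def)
  moreover have "\<exists>q::int. 0 \<le> q \<and> B \<le> len (u [^] q)" for B
  proof -
    obtain m :: nat where "B / \<eta> \<le> real m" using real_arch_simple by blast
    then have "B \<le> real m * \<eta>" using \<open>0 < \<eta>\<close> by (simp add: field_simps)
    then show ?thesis using *[of m] by (intro exI[of _ "int m"]) (simp add: int_pow_int)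
  qed
  ultimately show "loxodromic (C + 2 * \<delta>) u"
    using assms C delta_nonneg by (simp add: loxodromic_def)
qed

end

section \<open>Commensurability from acylindricity\<close>

text \<open>Conjugation by \<open>y\<close> and left invariance reduce a pair of points
  \<open>y\<close>, \<open>y \<otimes> x\<close> to the pair \<open>\<one>\<close>,
  \<open>x\<close>, so acylindricity of the orbit is stated for pairs containing
  \<open>\<one>\<close>.\<close>

locale acylindrical_group_metric = hyperbolic_group_metric +
  assumes acylindrical: "0 < \<epsilon> \<Longrightarrow> \<exists>R. \<exists>N::nat. \<forall>x\<in>carrier G. R \<le> d \<one> x \<longrightarrow>
    finite {e \<in> carrier G. d \<one> e \<le> \<epsilon> \<and> d x (e \<otimes> x) \<le> \<epsilon>} \<and>
    card {e \<in> carrier G. d \<one> e \<le> \<epsilon> \<and> d x (e \<otimes> x) \<le> \<epsilon>} \<le> N"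
begin

text \<open>If \<open>t [^] a\<close> is close to \<open>k \<otimes> s [^] j a\<close> for all \<open>a\<close> in a long interval, then \<open>j\<close> is coarsely
  additive, so \<open>k \<otimes> s [^] (j 0 - j a) \<otimes> inv k \<otimes> t [^] a\<close> moves both \<open>\<one>\<close> and a far away \<open>t [^] L\<close> by an
  amount bounded independently of \<open>a\<close>.  By acylindricity two of these elements coincide.\<close>

lemma commensurable_of_close:
  assumes t: "loxodromic C t" and s: "loxodromic C' s" and "0 \<le> K"
  obtains L0 :: int where "\<And>k. \<lbrakk>k \<in> carrier G;
      \<And>a. \<lbrakk>0 \<le> a; a \<le> L0\<rbrakk> \<Longrightarrow> \<exists>j::int. d (t [^] a) (k \<otimes> s [^] j) \<le> K\<rbrakk>
    \<Longrightarrow> \<exists>(p::int) (r::int). p \<noteq> 0 \<and> t [^] p = k \<otimes> s [^] r \<otimes> inv k"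
proof -
  \<comment> \<open>Displacement of \<open>t [^] L\<close>: one \<open>K\<close> at each end for
    passing to the line of \<open>s\<close>, and \<open>4 * K + 2 * C'\<close> for the coarse
    additivity of \<open>j\<close>. The summand 1 makes it positive.\<close>
  define \<epsilon> where "\<epsilon> = 6 * K + 2 * C' + 1"
  have "0 < \<epsilon>" using \<open>0 \<le> K\<close> loxodromic_nonneg[OF s] by (simp add: \<epsilon>_def)
  then obtain R and N :: nat where RN: "\<And>x. x \<in> carrier G \<Longrightarrow> R \<le> len x \<Longrightarrow>
      finite {e \<in> carrier G. len e \<le> \<epsilon> \<and> d x (e \<otimes> x) \<le> \<epsilon>} \<and>
      card {e \<in> carrier G. len e \<le> \<epsilon> \<and> d x (e \<otimes> x) \<le> \<epsilon>} \<le> N"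
    using acylindrical[of \<epsilon>] unfolding len_def by blast
  \<comment> \<open>Changing \<open>a\<close> by at most \<open>N\<close> changes \<open>j a\<close>
    by less than \<open>n1\<close>, whereas a change of \<open>a\<close> by \<open>L\<close>, chosen
    next, changes it by at least \<open>2 * n1\<close>. The interval of length \<open>N + L\<close>
    holds \<open>N + 1\<close> candidates \<open>a\<close> and their shifts by
    \<open>L\<close>.\<close>
  obtain n1 :: int where n1: "0 \<le> n1" "\<And>k. n1 \<le> \<bar>k\<bar> \<Longrightarrow> real N * len t + 2 * K + 1 \<le> len (s [^] k)"
    using loxodromic_proper[OF s] by blast
  obtain L :: int where L: "0 \<le> L" "max R (2 * n1 * len s + 2 * K + 1) \<le> len (t [^] L)"
    using t unfolding loxodromic_def by blast
  have tc [simp]: "t \<in> carrier G" and sc [simp]: "s \<in> carrier G" using t s by simp_all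
  have "\<exists>(p::int) (r::int). p \<noteq> 0 \<and> t [^] p = k \<otimes> s [^] r \<otimes> inv k"
    if k [simp]: "k \<in> carrier G"
      and close: "\<And>a. \<lbrakk>0 \<le> a; a \<le> int N + L\<rbrakk> \<Longrightarrow> \<exists>j::int. d (t [^] a) (k \<otimes> s [^] j) \<le> K" for k
  proof -
    have "\<forall>a\<in>{0..int N + L}. \<exists>j::int. d (t [^] a) (k \<otimes> s [^] j) \<le> K" using close by simp
    then obtain j :: "int \<Rightarrow> int" where "\<forall>a\<in>{0..int N + L}. d (t [^] a) (k \<otimes> s [^] j a) \<le> K"
      by (rule bchoice[THEN exE])
    then have j: "d (t [^] a) (k \<otimes> s [^] j a) \<le> K" if "0 \<le> a" "a \<le> int N + L" for a
      using that by simp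
    have shift: "\<bar>len (s [^] (j b - j a)) - len (t [^] (b - a))\<bar> \<le> 2 * K"
      if "0 \<le> a" "a \<le> int N + L" "0 \<le> b" "b \<le> int N + L" for a b
    proof -
      have "d (k \<otimes> s [^] j a) (k \<otimes> s [^] j b) = len (s [^] (j b - j a))"
        by (simp add: left_invariant dist_pow)
      moreover have "d (t [^] a) (t [^] b) = len (t [^] (b - a))"
        by (simp add: dist_pow)
      moreover have "d (t [^] a) (t [^] b) \<le> d (t [^] a) (k \<otimes> s [^] j a) + d (k \<otimes> s [^] j a) (k \<otimes> s [^] j b) + d (k \<otimes> s [^] j b) (t [^] b)"
        using triangle[of "t [^] a" "k \<otimes> s [^] j a" "t [^] b"]
          triangle[of "k \<otimes> s [^] j a" "k \<otimes> s [^] j b" "t [^] b"] by simp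
      moreover have "d (k \<otimes> s [^] j a) (k \<otimes> s [^] j b) \<le> d (k \<otimes> s [^] j a) (t [^] a) + d (t [^] a) (t [^] b) + d (t [^] b) (k \<otimes> s [^] j b)"
        using triangle[of "k \<otimes> s [^] j a" "t [^] a" "k \<otimes> s [^] j b"]
          triangle[of "t [^] a" "t [^] b" "k \<otimes> s [^] j b"] by simp
      ultimately show ?thesis
        using j[of a] j[of b] that commute[of "t [^] a" "k \<otimes> s [^] j a"]
          commute[of "t [^] b" "k \<otimes> s [^] j b"] by linarith
    qed
    define e where "e a = k \<otimes> s [^] (j 0 - j a) \<otimes> inv k \<otimes> t [^] a" for a
    have ec [simp]: "e a \<in> carrier G" for a by (simp add: e_def)
    \<comment> \<open>The conjugate \<open>c\<close> in \<open>e a\<close> slides the line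
      \<open>k \<otimes> s [^] _\<close> along itself. Taking \<open>b = 0\<close> and
      \<open>b = L\<close> locates the images of the two test points \<open>\<one>\<close> and
      \<open>t [^] L\<close>.\<close>
    have move: "d (e a \<otimes> t [^] b) (k \<otimes> s [^] (j 0 - j a + j (a + b))) \<le> K"
      if "0 \<le> a" "0 \<le> b" "a + b \<le> int N + L" for a b
    proof -
      define c where "c = k \<otimes> s [^] (j 0 - j a) \<otimes> inv k"
      have [simp]: "c \<in> carrier G" by (simp add: c_def)
      have "e a \<otimes> t [^] b = c \<otimes> t [^] (a + b)"
        by (simp add: e_def c_def m_assoc int_pow_mult)
      moreover have "k \<otimes> s [^] (j 0 - j a + j (a + b)) = c \<otimes> (k \<otimes> s [^] j (a + b))"
        by (simp add: c_def m_assoc int_pow_mult inv_mult_cancel)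
      ultimately show ?thesis using j[of "a + b"] that by (simp add: left_invariant)
    qed
    define E where "E = {x \<in> carrier G. len x \<le> \<epsilon> \<and> d (t [^] L) (x \<otimes> t [^] L) \<le> \<epsilon>}"
    have "e a \<in> E" if a: "0 \<le> a" "a \<le> int N" for a
    proof -
      have "d \<one> (k \<otimes> s [^] j 0) \<le> K" using j[of 0] L(1) by simp
      moreover have "d (e a) (k \<otimes> s [^] j 0) \<le> K" using move[of a 0] a L(1) by simp
      ultimately have "len (e a) \<le> 2 * K"
        using triangle[of \<one> "k \<otimes> s [^] j 0" "e a"] commute[of "e a"] by (simp add: len_def)
      moreover have "d (t [^] L) (e a \<otimes> t [^] L) \<le> 6 * K + 2 * C'"
      proof -
        define m where "m = j (a + L) - j a"
        define m' where "m' = j L - j 0"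
        have mL: "\<bar>len (s [^] m) - len (t [^] L)\<bar> \<le> 2 * K"
          using shift[of a "a + L"] a L(1) by (simp add: m_def)
        have m'L: "\<bar>len (s [^] m') - len (t [^] L)\<bar> \<le> 2 * K"
          using shift[of 0 L] L(1) by (simp add: m'_def)
        have ta: "len (t [^] a) \<le> real N * len t"
        proof -
          have "\<bar>real_of_int a\<bar> * len t \<le> real N * len t"
            using a len_nonneg by (intro mult_right_mono) auto
          then show ?thesis using len_pow_le[of t a] by simp
        qed
        \<comment> \<open>These two bounds give \<open>\<bar>m - m'\<bar> < 2 * n1\<close>. Since
          \<open>\<bar>m\<bar>\<close> is at least \<open>2 * n1\<close>, the exponents
          \<open>m\<close> and \<open>m'\<close> have the same sign, as
          \<open>loxodromic_diff\<close> demands.\<close>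
        have "\<bar>j (a + L) - j L\<bar> < n1"
          using shift[of L "a + L"] n1(2)[of "j (a + L) - j L"] a L(1) ta by fastforce
        moreover have "\<bar>j a - j 0\<bar> < n1"
          using shift[of 0 a] n1(2)[of "j a - j 0"] a L(1) ta by fastforce
        ultimately have "\<bar>m - m'\<bar> < 2 * n1" by (simp add: m_def m'_def)
        moreover have "2 * n1 \<le> \<bar>m\<bar>"
        proof (rule ccontr)
          assume "\<not> ?thesis"
          then have "\<bar>real_of_int m\<bar> * len s \<le> real_of_int (2 * n1) * len s"
            using len_nonneg by (intro mult_right_mono) linarith+
          then show False using len_pow_le[of s m] mL L(2) by (auto simp: abs_le_iff)
        qed
        ultimately have "0 \<le> m \<and> 0 \<le> m' \<or> m \<le> 0 \<and> m' \<le> 0" by linarith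
        then have "len (s [^] (m - m')) \<le> 4 * K + 2 * C'"
          using loxodromic_diff[OF s, of m m'] mL m'L by linarith
        moreover have "d (k \<otimes> s [^] j L) (k \<otimes> s [^] (j 0 - j a + j (a + L))) = len (s [^] (m - m'))"
          by (simp add: left_invariant dist_pow m_def m'_def algebra_simps)
        moreover have "d (e a \<otimes> t [^] L) (k \<otimes> s [^] (j 0 - j a + j (a + L))) \<le> K"
          using move[of a L] a L(1) by simp
        moreover have "d (t [^] L) (k \<otimes> s [^] j L) \<le> K" using j[of L] L(1) by simp
        ultimately show ?thesis
          using triangle[of "t [^] L" "k \<otimes> s [^] j L" "e a \<otimes> t [^] L"]
            triangle[of "k \<otimes> s [^] j L" "k \<otimes> s [^] (j 0 - j a + j (a + L))" "e a \<otimes> t [^] L"]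
            commute[of "e a \<otimes> t [^] L" "k \<otimes> s [^] (j 0 - j a + j (a + L))"] by simp
      qed
      ultimately show ?thesis
        using \<open>0 \<le> K\<close> loxodromic_nonneg[OF s] by (simp add: E_def \<epsilon>_def)
    qed
    then have "e ` {0..int N} \<subseteq> E" by auto
    moreover have "finite E" "card E \<le> N"
      using RN[of "t [^] L"] L(2) by (simp_all add: E_def)
    ultimately have "card (e ` {0..int N}) < card {0..int N}"
      using card_mono[of E "e ` {0..int N}"] by simp
    then have "\<not> inj_on e {0..int N}" by (rule pigeonhole)
    then obtain a b where ab: "a \<noteq> b" "e a = e b" by (auto simp: inj_on_def)
    define c where "c = k \<otimes> s [^] (j 0 - j b) \<otimes> inv k"
    define c' where "c' = k \<otimes> s [^] (j 0 - j a) \<otimes> inv k"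
    have [simp]: "c \<in> carrier G" "c' \<in> carrier G" by (simp_all add: c_def c'_def)
    have "c' \<otimes> t [^] a = c \<otimes> t [^] b" using ab(2) by (simp add: e_def c_def c'_def)
    then have "t [^] b = inv c \<otimes> (c' \<otimes> t [^] a)" by (simp add: inv_mult_cancel)
    then have "t [^] b \<otimes> inv (t [^] a) = inv c \<otimes> c'" by (simp add: m_assoc)
    moreover have "inv c \<otimes> c' = k \<otimes> s [^] (- (j 0 - j b) + (j 0 - j a)) \<otimes> inv k"
      unfolding c_def c'_def int_pow_mult[OF sc] int_pow_neg[OF sc]
      by (simp add: inv_mult_group m_assoc inv_mult_cancel)
    ultimately have "t [^] (b - a) = k \<otimes> s [^] (- (j 0 - j b) + (j 0 - j a)) \<otimes> inv k"
      by (simp add: int_pow_diff)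
    moreover have "b - a \<noteq> 0" using ab(1) by simp
    ultimately show ?thesis by blast
  qed
  then show thesis by (rule that)
qed

end

section \<open>Twisted elements \<open>t [^] M \<otimes> g\<close> and products of small
  sets\<close>

context acylindrical_group_metric
begin

text \<open>If the two rays ran together for too long, the points \<open>inv t [^] a\<close> on a
  long interval would lie near \<open>g \<otimes> t [^] _\<close>. Then
  \<open>commensurable_of_close\<close>, applied to \<open>inv t\<close> and \<open>t\<close>, would
  yield a relation excluded by \<open>g_t\<close>.\<close>

lemma ends_apart:
  assumes t: "loxodromic C t" and g [simp]: "g \<in> carrier G"
    and g_t: "\<And>(p::int) (q::int). p \<noteq> 0 \<Longrightarrow> t [^] p \<noteq> g \<otimes> t [^] q \<otimes> inv g"
  obtains B where "\<And>(p::int) (q::int). 0 \<le> p \<Longrightarrow> 0 \<le> q \<Longrightarrow> gp \<one> (t [^] (- p)) (g \<otimes> t [^] q) \<le> B"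
proof -
  have tc [simp]: "t \<in> carrier G" using t by simp
  have C: "0 \<le> C" using t by (rule loxodromic_nonneg)
  define K where "K = len t + 2 * (C + \<delta> + len g + C) + 2 * \<delta>"
  have "0 \<le> K" using C delta_nonneg len_nonneg by (simp add: K_def)
  then show thesis
  proof (rule commensurable_of_close[OF loxodromic_inv[OF t] t])
    fix L :: int
    assume L: "\<And>k. k \<in> carrier G \<Longrightarrow>
        (\<And>a. 0 \<le> a \<Longrightarrow> a \<le> L \<Longrightarrow> \<exists>j::int. d (inv t [^] a) (k \<otimes> t [^] j) \<le> K) \<Longrightarrow>
        \<exists>(p::int) (r::int). p \<noteq> 0 \<and> inv t [^] p = k \<otimes> t [^] r \<otimes> inv k"
    have inv_pow: "inv t [^] a = t [^] (- a)" for a :: int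
      by (simp add: int_pow_inv int_pow_neg)
    \<comment> \<open>No \<open>t [^] (- a)\<close> with \<open>0 \<le> a \<le> L\<close> is longer
      than \<open>B\<close>, so a product above \<open>B\<close> keeps all of these points on the
      common stretch of the two rays.\<close>
    define B where "B = real_of_int \<bar>L\<bar> * len t"
    have "gp \<one> (t [^] (- p)) (g \<otimes> t [^] q) \<le> B" if "0 \<le> p" "0 \<le> q" for p q :: int
    proof (rule ccontr)
      assume "\<not> ?thesis"
      then have big: "B < gp \<one> (t [^] (- p)) (g \<otimes> t [^] q)" by simp
      also have "\<dots> \<le> len (t [^] p)"
        using gp_le_dist[of \<one> "t [^] (- p)" "g \<otimes> t [^] q"] len_pow_minus[of t p]
        by (simp add: len_def commute[of _ \<one>])
      also have "\<dots> \<le> p * len t" using len_pow_le[of t p] \<open>0 \<le> p\<close> by simp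
      finally have "\<bar>L\<bar> < p"
        using mult_right_mono[of "real_of_int p" "real_of_int \<bar>L\<bar>" "len t"] len_nonneg[of t]
        by (auto simp: B_def not_less[symmetric] simp del: of_int_abs)
      have "\<exists>j::int. d (inv t [^] a) (g \<otimes> t [^] j) \<le> K" if a: "0 \<le> a" "a \<le> L" for a
      proof -
        define z where "z = t [^] (- a)"
        have [simp]: "z \<in> carrier G" by (simp add: z_def)
        have "gp z \<one> (t [^] (- p)) \<le> C"
          using loxodromic_between[OF t, of "-p" "-a" 0] a \<open>\<bar>L\<bar> < p\<close> gp_commute[of z \<one>]
          by (simp add: z_def)
        then have 1: "len z - C \<le> gp \<one> z (t [^] (- p))"
          using gp_add[of \<one> z "t [^] (- p)"] by (simp add: len_def)
        have "len z \<le> B"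
        proof -
          have "real_of_int a * len t \<le> real_of_int \<bar>L\<bar> * len t"
            using a len_nonneg[of t] by (intro mult_right_mono) auto
          then show ?thesis
            using len_pow_le[of t "- a"] a by (simp add: z_def B_def)
        qed
        then have "len z - C - \<delta> \<le> gp \<one> z (g \<otimes> t [^] q)"
          using four_point[of \<one> z "t [^] (- p)" "g \<otimes> t [^] q"] 1 big C by simp
        then have "gp z \<one> (g \<otimes> t [^] q) \<le> C + \<delta>"
          using gp_add[of \<one> z "g \<otimes> t [^] q"] by (simp add: len_def)
        then have "gp z (g \<otimes> t [^] (0::int)) (g \<otimes> t [^] q) \<le> C + \<delta> + len g"
          using gp_change[of z \<one> g "g \<otimes> t [^] q"] by (simp add: len_def)
        then show ?thesis
          using loxodromic_projection[OF t g, of z 0 q "C + \<delta> + len g"] by (simp add: K_def inv_pow z_def)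
      qed
      then have "\<exists>(p::int) (r::int). p \<noteq> 0 \<and> inv t [^] p = g \<otimes> t [^] r \<otimes> inv g"
        by (intro L) simp
      then obtain p r :: int where "p \<noteq> 0" "inv t [^] p = g \<otimes> t [^] r \<otimes> inv g"
        by (elim exE conjE)
      then show False using g_t[of "- p" r] by (simp add: inv_pow)
    qed
    then show thesis using that by blast
  qed
qed

text \<open>Translating by \<open>g\<close> turns the path of powers at a vertex into the rays of
  \<open>ends_apart\<close>, up to an error of \<open>2 * len g\<close>. This bounds the turn
  uniformly in \<open>M\<close>, while the step grows with \<open>M\<close>. Hence \<open>C'\<close>
  is fixed before \<open>\<eta>\<close> and \<open>m\<close>.\<close>

lemma loxodromic_twist:
  assumes t: "loxodromic C t" and g [simp]: "g \<in> carrier G"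
    and g_t: "\<And>(p::int) (q::int). p \<noteq> 0 \<Longrightarrow> t [^] p \<noteq> g \<otimes> t [^] q \<otimes> inv g"
  obtains C' where "\<And>\<eta>. \<exists>m::int. \<forall>M\<ge>m. loxodromic C' (t [^] M \<otimes> g) \<and>
      (\<forall>k::nat. real k * \<eta> \<le> len ((t [^] M \<otimes> g) [^] k))"
proof -
  have tc [simp]: "t \<in> carrier G" using t by simp
  obtain B where B: "\<And>(p::int) (q::int). 0 \<le> p \<Longrightarrow> 0 \<le> q \<Longrightarrow> gp \<one> (t [^] (- p)) (g \<otimes> t [^] q) \<le> B"
    using ends_apart[OF assms] by blast
  define C4 where "C4 = B + 2 * len g"
  have turn: "gp \<one> (inv (t [^] M \<otimes> g)) (t [^] M \<otimes> g) \<le> C4" if "0 \<le> M" for M :: int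
  proof -
    have "gp \<one> (inv (t [^] M \<otimes> g)) (t [^] M \<otimes> g) = gp g (t [^] (- M)) (g \<otimes> t [^] M \<otimes> g)"
      using gp_left_invariant[of g \<one> "inv (t [^] M \<otimes> g)" "t [^] M \<otimes> g"]
      by (simp add: inv_mult_group int_pow_neg inv_mult_cancel m_assoc)
    also have "\<dots> \<le> gp \<one> (t [^] (- M)) (g \<otimes> t [^] M \<otimes> g) + len g"
      using gp_change_base[of \<one> g] by (simp add: len_def)
    also have "gp \<one> (t [^] (- M)) (g \<otimes> t [^] M \<otimes> g) \<le> gp \<one> (t [^] (- M)) (g \<otimes> t [^] M) + len g"
      using gp_change[of \<one> "g \<otimes> t [^] M" "g \<otimes> t [^] M \<otimes> g" "t [^] (- M)"]
        dist_mult_right[of "g \<otimes> t [^] M" g] gp_commute[of \<one> "t [^] (- M)" "g \<otimes> t [^] M"]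
        gp_commute[of \<one> "t [^] (- M)" "g \<otimes> t [^] M \<otimes> g"] by simp
    finally show ?thesis using B[of M M] that by (simp add: C4_def)
  qed
  have "\<exists>m::int. \<forall>M\<ge>m. loxodromic (C4 + 2 * \<delta>) (t [^] M \<otimes> g) \<and>
      (\<forall>k::nat. real k * \<eta> \<le> len ((t [^] M \<otimes> g) [^] k))" for \<eta>
  proof -
    define \<eta>' where "\<eta>' = max \<eta> 1"
    obtain m :: int where m: "0 \<le> m" "\<And>k. m \<le> \<bar>k\<bar> \<Longrightarrow> 2 * C4 + 3 * \<delta> + \<eta>' + len g \<le> len (t [^] k)"
      using loxodromic_proper[OF t] by blast
    have "loxodromic (C4 + 2 * \<delta>) (t [^] M \<otimes> g) \<and>
      (\<forall>k::nat. real k * \<eta> \<le> len ((t [^] M \<otimes> g) [^] k))" if "m \<le> M" for M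
    proof -
      have long: "2 * C4 + 3 * \<delta> + \<eta>' \<le> len (t [^] M \<otimes> g)"
        using m(2)[of M] that m(1) len_mult_ge[of "t [^] M" g] by simp
      have "real k * \<eta> \<le> real k * \<eta>'" for k :: nat
        by (intro mult_left_mono) (auto simp: \<eta>'_def)
      moreover have "0 < \<eta>'" by (simp add: \<eta>'_def)
      moreover have "gp \<one> (inv (t [^] M \<otimes> g)) (t [^] M \<otimes> g) \<le> C4"
        using turn[of M] that m(1) by simp
      moreover have "t [^] M \<otimes> g \<in> carrier G" by simp
      ultimately show ?thesis
        using loxodromic_local_criterion[of "t [^] M \<otimes> g" C4 \<eta>', OF _ _ long]
        by (meson order_trans)
    qed
    then show ?thesis by blast
  qed
  then show thesis by (rule that)
qed

text \<open>Points near a segment of length at most \<open>B\<close> are within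
  \<open>2 * K + 2 * B\<close> of each other, whereas for large \<open>M\<close> distinct powers of
  \<open>u\<close> are at least \<open>\<eta>\<close> apart.\<close>

lemma twist_not_near_bounded:
  assumes g: "g \<in> carrier G" "t \<in> carrier G"
    and twist: "\<And>\<eta>. \<exists>m::int. \<forall>M\<ge>m. loxodromic C' (t [^] M \<otimes> g) \<and>
      (\<forall>k::nat. real k * \<eta> \<le> len ((t [^] M \<otimes> g) [^] k))"
  shows "\<exists>m::int. \<forall>M\<ge>m. \<forall>P\<in>carrier G. \<forall>Q\<in>carrier G. d P Q \<le> B \<longrightarrow> (\<forall>(l::int) (l'::int). l < l' \<longrightarrow>
      \<not> (gp ((t [^] M \<otimes> g) [^] l) P Q \<le> K \<and> gp ((t [^] M \<otimes> g) [^] l') P Q \<le> K))"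
proof -
  define \<eta> where "\<eta> = 2 * \<bar>K\<bar> + 2 * \<bar>B\<bar> + 1"
  obtain m :: int where m: "\<And>M k. m \<le> M \<Longrightarrow> real k * \<eta> \<le> len ((t [^] M \<otimes> g) [^] (k::nat))"
    using twist[of \<eta>] by blast
  have False
    if M: "m \<le> M" and PQ: "P \<in> carrier G" "Q \<in> carrier G" "d P Q \<le> B" and "l < l'"
      and gpK: "gp ((t [^] M \<otimes> g) [^] l) P Q \<le> K" "gp ((t [^] M \<otimes> g) [^] l') P Q \<le> K"
    for M l l' :: int and P Q
  proof -
    define u where "u = t [^] M \<otimes> g"
    have [simp]: "u \<in> carrier G" using g by (simp add: u_def)
    have near: "d P z \<le> K + B" if "z \<in> carrier G" "gp z P Q \<le> K" for z
      using that PQ gp_double[of z P Q] triangle[of P Q z] by simp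
    have "d (u [^] l) (u [^] l') \<le> 2 * K + 2 * B"
      using near[of "u [^] l"] near[of "u [^] l'"] gpK[folded u_def] PQ
        triangle[of "u [^] l" P "u [^] l'"] commute[of "u [^] l" P] by simp
    moreover have "d (u [^] l) (u [^] l') = len (u [^] nat (l' - l))"
      using \<open>l < l'\<close> by (simp add: dist_pow pow_nat)
    moreover have "real (nat (l' - l)) * \<eta> \<le> len (u [^] nat (l' - l))"
      unfolding u_def by (rule m) fact
    moreover have "1 * \<eta> \<le> real (nat (l' - l)) * \<eta>"
      using \<open>l < l'\<close> by (intro mult_right_mono) (auto simp: \<eta>_def)
    ultimately show False using \<eta>_def by linarith
  qed
  then show ?thesis by blast
qed

text \<open>Two consecutive translates of the \<open>t\<close>-segment of length \<open>M\<close> near the same translate of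
  the axis of \<open>s\<close> make the axis of \<open>t\<close> parallel to its translate by \<open>g\<close>.\<close>

lemma twist_not_near_axis:
  assumes t: "loxodromic C t" and g [simp]: "g \<in> carrier G"
    and g_t: "\<And>(p::int) (q::int). p \<noteq> 0 \<Longrightarrow> t [^] p \<noteq> g \<otimes> t [^] q \<otimes> inv g"
    and twist: "\<And>\<eta>. \<exists>m::int. \<forall>M\<ge>m. loxodromic C' (t [^] M \<otimes> g) \<and>
      (\<forall>k::nat. real k * \<eta> \<le> len ((t [^] M \<otimes> g) [^] k))"
    and s: "loxodromic C'' s" and "0 \<le> K" "0 \<le> D"
  shows "\<exists>m::int. \<forall>M\<ge>m. \<forall>P\<in>carrier G. \<forall>Q\<in>carrier G. (\<exists>j::int. d Q (P \<otimes> s [^] j) \<le> D) \<longrightarrow>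
      (\<forall>(l::int) (l'::int). l + 2 \<le> l' \<longrightarrow>
        \<not> (gp ((t [^] M \<otimes> g) [^] l) P Q \<le> K \<and> gp ((t [^] M \<otimes> g) [^] l') P Q \<le> K))"
proof -
  have tc [simp]: "t \<in> carrier G" and sc [simp]: "s \<in> carrier G" using t s by simp_all
  note C = loxodromic_nonneg[OF t] and C'' = loxodromic_nonneg[OF s]
  obtain m0 :: int where m0: "\<And>M. m0 \<le> M \<Longrightarrow> loxodromic C' (t [^] M \<otimes> g)"
    using twist[of 0] by blast
  have C': "0 \<le> C'" using m0[of m0] loxodromic_nonneg by blast
  \<comment> \<open>A point of a \<open>t\<close>-segment has product at most
    \<open>C + len g\<close> with the ends of its step of the \<open>u\<close>-path. Two uses of
    \<open>between_trans\<close> pass first to a longer stretch of that path and then to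
    \<open>P\<close>, \<open>Q\<close>. In \<open>K7\<close>, \<open>D\<close> pays for moving
    \<open>Q\<close> onto the line of \<open>s\<close>, and the rest is the projection to that
    line.\<close>
  define K6 where "K6 = K + (C' + (C + len g) + \<delta>) + \<delta>"
  define K7 where "K7 = len s + 2 * (K6 + D + C'') + 2 * \<delta>"
  have "0 \<le> K7"
    using C C' C'' \<open>0 \<le> K\<close> \<open>0 \<le> D\<close> delta_nonneg len_nonneg by (simp add: K7_def K6_def)
  then show ?thesis
  proof (rule commensurable_of_close[OF t s])
    fix L :: int
    assume L: "\<And>k. k \<in> carrier G \<Longrightarrow>
        (\<And>a. 0 \<le> a \<Longrightarrow> a \<le> L \<Longrightarrow> \<exists>j::int. d (t [^] a) (k \<otimes> s [^] j) \<le> K7) \<Longrightarrow>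
        \<exists>(p::int) (r::int). p \<noteq> 0 \<and> t [^] p = k \<otimes> s [^] r \<otimes> inv k"
    have False
      if M: "max m0 L \<le> M" and P [simp]: "P \<in> carrier G" and Q [simp]: "Q \<in> carrier G"
        and j: "d Q (P \<otimes> s [^] j) \<le> D" and "l + 2 \<le> l'"
        and gpK: "gp ((t [^] M \<otimes> g) [^] l) P Q \<le> K" "gp ((t [^] M \<otimes> g) [^] l') P Q \<le> K"
      for M l l' j :: int and P Q
    proof -
      define u where "u = t [^] M \<otimes> g"
      have u: "loxodromic C' u" using m0[of M] M by (simp add: u_def)
      then have uc [simp]: "u \<in> carrier G" by simp
      \<comment> \<open>The \<open>t\<close>-segment starting at \<open>u [^] i\<close>, pulled back
        to \<open>\<one>\<close>, follows a translate of the line of \<open>s\<close> for all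
        \<open>a \<le> L \<le> M\<close>.\<close>
      have par: "\<exists>(p::int) (r::int). p \<noteq> 0 \<and> t [^] p = (inv (u [^] i) \<otimes> P) \<otimes> s [^] r \<otimes> inv (inv (u [^] i) \<otimes> P)"
        if i: "l \<le> i" "i + 1 \<le> l'" for i
      proof (rule L)
        show "inv (u [^] i) \<otimes> P \<in> carrier G" by simp
      next
        fix a assume a: "0 \<le> a" "a \<le> L"
        show "\<exists>j::int. d (t [^] a) (inv (u [^] i) \<otimes> P \<otimes> s [^] j) \<le> K7"
        proof -
          define z where "z = u [^] i \<otimes> t [^] a"
          have zc [simp]: "z \<in> carrier G" by (simp add: z_def)
          have "gp (t [^] a) \<one> (t [^] M) \<le> C"
            using loxodromic_between[OF t, of 0 a M] a M by simp
          then have "gp (t [^] a) \<one> u \<le> C + len g"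
            using gp_change[of "t [^] a" "t [^] M" u \<one>] dist_mult_right[of "t [^] M" g]
              gp_commute[of "t [^] a" \<one> "t [^] M"] gp_commute[of "t [^] a" \<one> u] by (simp add: u_def)
          moreover have "gp z (u [^] i) (u [^] (i + 1)) = gp (t [^] a) \<one> u"
            using gp_left_invariant[of "u [^] i" "t [^] a" \<one> u] by (simp add: z_def int_pow_mult)
          moreover have "gp (u [^] i) (u [^] l) (u [^] l') \<le> C'"
            "gp (u [^] (i + 1)) (u [^] l) (u [^] l') \<le> C'"
            using loxodromic_between[OF u, of l i l'] loxodromic_between[OF u, of l "i + 1" l'] i by simp_all
          ultimately have "gp z (u [^] l) (u [^] l') \<le> C' + (C + len g) + \<delta>"
            using between_trans[of "u [^] l" "u [^] l'" z "u [^] i" "u [^] (i + 1)"] by simp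
          then have "gp z P Q \<le> K6"
            using between_trans[of P Q z "u [^] l" "u [^] l'" K "C' + (C + len g) + \<delta>"] gpK by (simp add: K6_def u_def)
          then have "gp z P (P \<otimes> s [^] j) \<le> K6 + D"
            using gp_change[of z Q "P \<otimes> s [^] j" P] j gp_commute[of z P Q]
              gp_commute[of z P "P \<otimes> s [^] j"] by simp
          then obtain k :: int where "d z (P \<otimes> s [^] k) \<le> K7"
            using loxodromic_projection[OF s P zc, of 0 j "K6 + D"] by (auto simp: K7_def)
          then show "\<exists>j::int. d (t [^] a) (inv (u [^] i) \<otimes> P \<otimes> s [^] j) \<le> K7"
            using left_invariant[of "u [^] i" "t [^] a" "inv (u [^] i) \<otimes> P \<otimes> s [^] k"]
            by (intro exI[of _ k]) (simp add: z_def m_assoc inv_mult_cancel)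
        qed
      qed
      \<comment> \<open>The translates for \<open>i = l\<close> and \<open>i = l + 1\<close> differ
        by one factor \<open>u\<close>, so \<open>k\<close> serves both. The gap
        \<open>l + 2 \<le> l'\<close> is what admits \<open>i = l + 1\<close>.\<close>
      define k where "k = inv (u [^] (l + 1)) \<otimes> P"
      have kc [simp]: "k \<in> carrier G" by (simp add: k_def)
      have k': "inv (u [^] l) \<otimes> P = u \<otimes> k"
        using int_pow_mult[of u l 1] by (simp add: k_def inv_mult_group m_assoc inv_mult_cancel)
      obtain p r :: int where pr: "p \<noteq> 0" "t [^] p = (u \<otimes> k) \<otimes> s [^] r \<otimes> inv (u \<otimes> k)"
        using par[of l] \<open>l + 2 \<le> l'\<close> k' by auto
      obtain p' r' :: int where pr': "p' \<noteq> 0" "t [^] p' = k \<otimes> s [^] r' \<otimes> inv k"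
        using par[of "l + 1"] \<open>l + 2 \<le> l'\<close> unfolding k_def by auto
      \<comment> \<open>Otherwise \<open>t\<close> would have finite order. Raising the two
        relations to the powers \<open>r'\<close> and \<open>r\<close> equates the exponents of
        \<open>s\<close> and eliminates it. The factor \<open>t [^] M\<close> of \<open>u\<close>
        then drops out, since it commutes with powers of \<open>t\<close>, and \<open>p * r'\<close>
        is still nonzero.\<close>
      have "r' \<noteq> 0"
        using pr' loxodromic_pow_neq_one[OF t, of p'] by auto
      have "t [^] (p * r') = (t [^] p) [^] r'" by (simp add: int_pow_pow)
      also have "\<dots> = (u \<otimes> k) \<otimes> s [^] (r * r') \<otimes> inv (u \<otimes> k)"
        unfolding pr(2) using int_pow_conj[of "u \<otimes> k" "s [^] r" r'] by (simp add: int_pow_pow)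
      also have "\<dots> = u \<otimes> (k \<otimes> s [^] (r' * r) \<otimes> inv k) \<otimes> inv u"
        by (simp add: inv_mult_group m_assoc mult.commute)
      also have "k \<otimes> s [^] (r' * r) \<otimes> inv k = t [^] (p' * r)"
        using int_pow_conj[of k "s [^] r'" r] int_pow_pow[OF tc, of p' r] unfolding pr'(2)
        by (simp add: int_pow_pow)
      also have "u \<otimes> t [^] (p' * r) \<otimes> inv u = t [^] M \<otimes> (g \<otimes> t [^] (p' * r) \<otimes> inv g) \<otimes> inv (t [^] M)"
        by (simp add: u_def inv_mult_group m_assoc)
      finally have eq: "t [^] (p * r') = t [^] M \<otimes> (g \<otimes> t [^] (p' * r) \<otimes> inv g) \<otimes> inv (t [^] M)" .
      have "g \<otimes> t [^] (p' * r) \<otimes> inv g = inv (t [^] M) \<otimes> t [^] (p * r') \<otimes> t [^] M"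
        unfolding eq by (simp add: m_assoc inv_mult_cancel)
      also have "\<dots> = t [^] (- M + p * r' + M)"
        by (simp only: int_pow_mult int_pow_neg tc)
      finally have "t [^] (p * r') = g \<otimes> t [^] (p' * r) \<otimes> inv g" by simp
      then show False using g_t[of "p * r'" "p' * r"] pr(1) \<open>r' \<noteq> 0\<close> by simp
    qed
    then show ?thesis by (intro exI[of _ "max m0 L"]) blast
  qed
qed

text \<open>A factorization is encoded by its partial products \<open>p\<close>, the vertices of an
  \<open>n\<close>-gon path from \<open>\<one>\<close> to \<open>x\<close> with one side for each
  factor.\<close>

theorem not_bounded_product:
  assumes t: "loxodromic C t" and g: "g \<in> carrier G"
    and g_t: "\<And>(p::int) (q::int). p \<noteq> 0 \<Longrightarrow> t [^] p \<noteq> g \<otimes> t [^] q \<otimes> inv g"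
    and "1 \<le> n" and H: "\<And>i. i < n \<Longrightarrow> H i \<subseteq> carrier G"
    and small: "\<And>i. i < n \<Longrightarrow> (\<exists>B. \<forall>h\<in>H i. len h \<le> B) \<or>
      (\<exists>C s D. loxodromic C s \<and> (\<forall>h\<in>H i. \<exists>j::int. d h (s [^] j) \<le> D))"
  shows "\<exists>x\<in>carrier G. \<forall>p. p 0 = \<one> \<longrightarrow> (\<forall>i<n. \<exists>h\<in>H i. p (Suc i) = p i \<otimes> h) \<longrightarrow> p n \<noteq> x"
proof -
  have tc: "t \<in> carrier G" using t by simp
  obtain C' where twist: "\<And>\<eta>. \<exists>m::int. \<forall>M\<ge>m. loxodromic C' (t [^] M \<otimes> g) \<and>
      (\<forall>k::nat. real k * \<eta> \<le> len ((t [^] M \<otimes> g) [^] k))"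
    using loxodromic_twist[OF t g g_t] by blast
  then obtain m0 :: int where m0: "\<And>M. m0 \<le> M \<Longrightarrow> loxodromic C' (t [^] M \<otimes> g)"
    by blast
  \<comment> \<open>Powers of \<open>u\<close> between \<open>\<one>\<close> and the endpoint have
    product at most \<open>C'\<close> with these two, and \<open>polygon\<close> adds
    \<open>n\<close> times \<open>\<delta>\<close>. No \<open>M\<close> enters.\<close>
  define K where "K = C' + real n * \<delta>"
  have "0 \<le> K" using m0[of m0] loxodromic_nonneg delta_nonneg by (simp add: K_def)
  \<comment> \<open>The threshold \<open>m\<close> may depend on the factor; as \<open>Q\<close>
    speaks of all \<open>M \<ge> m\<close>, the maximum over the finitely many factors works for all
    of them.\<close>
  define Q where "Q i m \<longleftrightarrow> (\<forall>M\<ge>m. \<forall>P\<in>carrier G. \<forall>h\<in>H i. \<forall>(l::int) (l'::int). l + 2 \<le> l' \<longrightarrow>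
      \<not> (gp ((t [^] M \<otimes> g) [^] l) P (P \<otimes> h) \<le> K \<and> gp ((t [^] M \<otimes> g) [^] l') P (P \<otimes> h) \<le> K))"
    for i and m :: int
  have "\<exists>m. Q i m"
    if i: "i < n" for i
  proof -
    have Hc: "h \<in> carrier G" if "h \<in> H i" for h using H[OF i] that by blast
    consider B where "\<And>h. h \<in> H i \<Longrightarrow> len h \<le> B"
      | C'' s D where "loxodromic C'' s" "\<And>h. h \<in> H i \<Longrightarrow> \<exists>j::int. d h (s [^] j) \<le> D"
      using small[OF i] by blast
    then show ?thesis
    proof cases
      case 1
      obtain m :: int where m: "\<And>M P Q l l'. m \<le> M \<Longrightarrow> P \<in> carrier G \<Longrightarrow> Q \<in> carrier G \<Longrightarrow>
          d P Q \<le> B \<Longrightarrow> l < l' \<Longrightarrow>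
          \<not> (gp ((t [^] M \<otimes> g) [^] (l::int)) P Q \<le> K \<and> gp ((t [^] M \<otimes> g) [^] (l'::int)) P Q \<le> K)"
        using twist_not_near_bounded[OF g tc twist, of B K] by blast
      have "Q i m"
        unfolding Q_def by (intro allI impI ballI m) (use Hc 1 in \<open>auto simp: dist_mult_right\<close>)
      then show ?thesis ..
    next
      case 2
      obtain m :: int where m: "\<And>M P Q l l'. m \<le> M \<Longrightarrow> P \<in> carrier G \<Longrightarrow> Q \<in> carrier G \<Longrightarrow>
          \<exists>j::int. d Q (P \<otimes> s [^] j) \<le> max 0 D \<Longrightarrow> l + 2 \<le> l' \<Longrightarrow>
          \<not> (gp ((t [^] M \<otimes> g) [^] (l::int)) P Q \<le> K \<and> gp ((t [^] M \<otimes> g) [^] (l'::int)) P Q \<le> K)"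
        using twist_not_near_axis[OF t g g_t twist 2(1) \<open>0 \<le> K\<close> max.cobounded1[of 0 D]] by blast
      have "\<exists>j::int. d (P \<otimes> h) (P \<otimes> s [^] j) \<le> max 0 D" if "P \<in> carrier G" "h \<in> H i" for P h
        using 2 Hc that by (auto simp: left_invariant le_max_iff_disj)
      then have "Q i m"
        unfolding Q_def by (intro allI impI ballI m) (use Hc in auto)
      then show ?thesis ..
    qed
  qed
  then obtain m where "\<And>i. i < n \<Longrightarrow> Q i (m i)" by metis
  then have m: "\<And>i M P h l l'. i < n \<Longrightarrow> m i \<le> M \<Longrightarrow> P \<in> carrier G \<Longrightarrow>
      h \<in> H i \<Longrightarrow> l + 2 \<le> l' \<Longrightarrow>
      \<not> (gp ((t [^] M \<otimes> g) [^] (l::int)) P (P \<otimes> h) \<le> K \<and> gp ((t [^] M \<otimes> g) [^] (l'::int)) P (P \<otimes> h) \<le> K)"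
    unfolding Q_def by blast
  define M where "M = Max (insert m0 (m ` {..<n}))"
  have Mge: "m0 \<le> M" "\<And>i. i < n \<Longrightarrow> m i \<le> M" by (auto simp: M_def)
  define u where "u = t [^] M \<otimes> g"
  have u: "loxodromic C' u" unfolding u_def by (rule m0) (rule Mge)
  then have uc [simp]: "u \<in> carrier G" by simp
  have "p n \<noteq> u [^] (2 * int n)"
    if p0: "p 0 = \<one>" and step: "\<forall>i<n. \<exists>h\<in>H i. p (Suc i) = p i \<otimes> h" for p
  proof
    assume pn: "p n = u [^] (2 * int n)"
    have pc: "p i \<in> carrier G" if "i \<le> n" for i
      using that
    proof (induction i)
      case (Suc i)
      then obtain h where "h \<in> H i" "p (Suc i) = p i \<otimes> h"
        using step by (meson Suc_le_eq)
      then show ?case using Suc H[of i] by auto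
    qed (simp add: p0)
    \<comment> \<open>The indices \<open>j = 0, ..., n\<close> are one more than the sides, and
      doubling them keeps any two of the chosen powers at least two steps apart.\<close>
    have "\<exists>i<n. gp (u [^] (2 * int j)) (p i) (p (Suc i)) \<le> K" if "j \<le> n" for j
    proof -
      have "gp (u [^] (2 * int j)) (p 0) (p n) \<le> C'"
        using loxodromic_between[OF u, of 0 "2 * int j" "2 * int n"] that p0 pn by simp
      then show ?thesis
        using polygon[of n p "u [^] (2 * int j)" C'] pc \<open>1 \<le> n\<close> by (simp add: K_def)
    qed
    then have "\<forall>j\<in>{..n}. \<exists>i. i < n \<and> gp (u [^] (2 * int j)) (p i) (p (Suc i)) \<le> K" by simp
    then obtain f where
      "\<forall>j\<in>{..n}. f j < n \<and> gp (u [^] (2 * int j)) (p (f j)) (p (Suc (f j))) \<le> K"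
      by (rule bchoice[THEN exE])
    then have f: "f j < n" "gp (u [^] (2 * int j)) (p (f j)) (p (Suc (f j))) \<le> K" if "j \<le> n" for j
      using that by simp_all
    have "f ` {..n} \<subseteq> {..<n}" using f(1) by auto
    then have "card (f ` {..n}) < card {..n}"
      using card_mono[of "{..<n}" "f ` {..n}"] by simp
    then have "\<not> inj_on f {..n}" by (rule pigeonhole)
    then obtain a b where ab: "a \<le> n" "b \<le> n" "a \<noteq> b" "f a = f b"
      by (auto simp: inj_on_def)
    define j where "j = min a b"
    define j' where "j' = max a b"
    have jj': "j \<le> n" "j' \<le> n" "j < j'" "f j' = f j"
      using ab by (auto simp: j_def j'_def min_def max_def)
    obtain h where h: "h \<in> H (f j)" "p (Suc (f j)) = p (f j) \<otimes> h"
      using step f(1)[OF jj'(1)] by blast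
    have "2 * int j + 2 \<le> 2 * int j'" using jj'(3) by simp
    moreover have "p (f j) \<in> carrier G" using pc[of "f j"] f(1)[OF jj'(1)] by simp
    moreover have "gp (u [^] (2 * int j)) (p (f j)) (p (f j) \<otimes> h) \<le> K"
      using f(2)[OF jj'(1)] h(2) by simp
    moreover have "gp (u [^] (2 * int j')) (p (f j)) (p (f j) \<otimes> h) \<le> K"
      using f(2)[OF jj'(2)] h(2) jj'(4) by simp
    ultimately show False
      using m[OF f(1)[OF jj'(1)] Mge(2)[OF f(1)[OF jj'(1)]] _ h(1)] unfolding u_def by blast
  qed
  then show ?thesis by (intro bexI[of _ "u [^] (2 * int n)"]) auto
qed

end

section \<open>Finding loxodromic elements\<close>

context hyperbolic_group_metric
begin

text \<open>If \<open>g\<close> and \<open>h\<close> left \<open>\<one>\<close> in different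
  directions and neither were loxodromic, then \<open>g \<otimes> h\<close> would be: each of them
  points the same way as its inverse, so the path of powers of \<open>g \<otimes> h\<close> hardly
  turns back.\<close>

lemma gp_ge_if_no_loxodromic:
  assumes H: "subgroup H G" and no_lox: "\<And>f C. f \<in> H \<Longrightarrow> \<not> loxodromic C f"
    and "g \<in> H" "h \<in> H"
  shows "min (len g) (len h) / 2 - (4 * \<delta> + 1) \<le> gp \<one> g h"
proof (rule ccontr)
  assume "\<not> ?thesis"
  then have small: "len g > 2 * gp \<one> g h + 8 * \<delta> + 2" "len h > 2 * gp \<one> g h + 8 * \<delta> + 2"
    by linarith+
  have [simp]: "g \<in> carrier G" "h \<in> carrier G"
    using assms subgroup.mem_carrier by metis+
  have turn: "2 * gp \<one> (inv f) f + 3 * \<delta> + 1 > len f" if "f \<in> H" for f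
    using loxodromic_local_criterion(1)[of f "gp \<one> (inv f) f" 1] no_lox[OF that] that
      subgroup.mem_carrier[OF H] by force
  define c where "c = gp \<one> g h + \<delta>"
  define u where "u = g \<otimes> h"
  have uc [simp]: "u \<in> carrier G" by (simp add: u_def)
  have inv_u: "inv u = inv h \<otimes> inv g" by (simp add: u_def inv_mult_group)
  \<comment> \<open>By \<open>turn\<close>, \<open>inv g\<close> and \<open>g\<close> run together
    beyond the point where \<open>g\<close> and \<open>h\<close> separate, so \<open>inv g\<close>
    separates from \<open>h\<close> at about the same place.\<close>
  have ig_h: "gp \<one> (inv g) h \<le> c"
    using four_point[of \<one> g "inv g" h] turn[OF \<open>g \<in> H\<close>] small gp_commute[of \<one> g "inv g"]
      delta_nonneg unfolding c_def by simp
  have ih_g: "gp \<one> (inv h) g \<le> c"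
    using four_point[of \<one> g "inv h" h] turn[OF \<open>h \<in> H\<close>] small
      gp_commute[of \<one> g "inv h"] delta_nonneg unfolding c_def by simp
  have gu: "gp g \<one> u = gp \<one> (inv g) h"
    using gp_left_invariant[of g \<one> "inv g" h] by (simp add: u_def)
  have hu: "gp (inv h) \<one> (inv u) = gp \<one> h (inv g)"
    using gp_left_invariant[of "inv h" \<one> h "inv g"] by (simp add: inv_u)
  have g_u: "gp \<one> g u \<ge> len g - c"
    using gp_add[of \<one> g u] gu ig_h by (simp add: len_def)
  have h_u: "gp \<one> (inv h) (inv u) \<ge> len h - c"
    using gp_add[of \<one> "inv h" "inv u"] hu ig_h gp_commute[of \<one> h "inv g"] len_inv[of h]
    by (simp add: len_def)
  \<comment> \<open>Seen from \<open>\<one>\<close>, \<open>inv u\<close> starts like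
    \<open>inv h\<close> and \<open>u\<close> starts like \<open>g\<close>. Exchanging both costs
    \<open>2 * \<delta>\<close> over the bound \<open>ih_g\<close>.\<close>
  have "gp \<one> (inv u) g \<le> c + \<delta>"
    using four_point[of \<one> "inv h" "inv u" g] ih_g h_u small delta_nonneg unfolding c_def by simp
  then have "gp \<one> (inv u) u \<le> c + 2 * \<delta>"
    using four_point[of \<one> "inv u" u g] g_u gp_commute[of \<one> u g] small delta_nonneg
    unfolding c_def by simp
  moreover have "2 * (c + 2 * \<delta>) + 3 * \<delta> + 1 \<le> len u"
  proof -
    have "len u = len g + len h - 2 * gp g \<one> u"
      using gp_double[of g \<one> u] dist_mult_right[of g h] commute[of u g] by (simp add: len_def u_def)
    then show ?thesis using gu ig_h small delta_nonneg by (simp add: c_def)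
  qed
  ultimately have "loxodromic (c + 2 * \<delta> + 2 * \<delta>) u"
    using loxodromic_local_criterion(1)[of u "c + 2 * \<delta>" 1] by simp
  moreover have "u \<in> H" using assms by (simp add: u_def subgroup.m_closed)
  ultimately show False using no_lox by blast
qed

text \<open>Seen from \<open>h\<close>, the two halves of the translated axis are nearly opposite.
  If each half points towards a power of \<open>t\<close>, two uses of \<open>four_point\<close> put
  \<open>h\<close> nearly between these powers, and it projects to the axis with a constant that
  does not involve \<open>h\<close>.\<close>

lemma near_axis_of_ends:
  fixes m m' a b :: int
  assumes t: "loxodromic C t" and h [simp]: "h \<in> carrier G" and "0 \<le> m" "0 \<le> m'"
    and a: "C + 2 * \<delta> < gp h (h \<otimes> t [^] m) (t [^] a)"
    and b: "C + 2 * \<delta> < gp h (h \<otimes> t [^] (- m')) (t [^] b)"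
  shows "\<exists>l::int. d h (t [^] l) \<le> len t + 4 * C + 6 * \<delta>"
proof -
  have [simp]: "t \<in> carrier G" using t by simp
  have "gp h (h \<otimes> t [^] (- m')) (h \<otimes> t [^] m) \<le> C"
    using loxodromic_between[OF t, of "- m'" 0 m] assms
      gp_left_invariant[of h "t [^] (0::int)" "t [^] (- m')" "t [^] m"] by simp
  then have "gp h (h \<otimes> t [^] (- m')) (t [^] a) \<le> C + \<delta>"
    using four_point[of h "h \<otimes> t [^] (- m')" "t [^] a" "h \<otimes> t [^] m"] a delta_nonneg
      gp_commute[of h "t [^] a" "h \<otimes> t [^] m"] by simp
  then have "gp h (t [^] b) (t [^] a) \<le> C + 2 * \<delta>"
    using four_point[of h "h \<otimes> t [^] (- m')" "t [^] b" "t [^] a"] b by simp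
  then have "gp h (\<one> \<otimes> t [^] b) (\<one> \<otimes> t [^] a) \<le> C + 2 * \<delta>" by simp
  from loxodromic_projection[OF t one_closed h this] show ?thesis
    by (simp add: algebra_simps)
qed

text \<open>The relation gives \<open>g \<otimes> t [^] (q * k) = t [^] (p * k) \<otimes> g\<close>,
  which is within \<open>len g\<close> of the axis. For \<open>k = n\<close> and
  \<open>k = - n\<close> with \<open>n\<close> large this puts both ends of the translated axis
  along the original one; a negative \<open>q\<close> is treated by inverting the relation.\<close>

lemma near_axis_of_commensurating:
  fixes p q :: int
  assumes t: "loxodromic C t" and g [simp]: "g \<in> carrier G" and "p \<noteq> 0"
    and eq: "t [^] p = g \<otimes> t [^] q \<otimes> inv g"
  shows "\<exists>l::int. d g (t [^] l) \<le> len t + 4 * C + 6 * \<delta>"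
proof -
  have *: ?thesis if "p \<noteq> 0" "0 \<le> q" and eq: "t [^] p = g \<otimes> t [^] q \<otimes> inv g" for p q :: int
  proof -
    have [simp]: "t \<in> carrier G" using t by simp
    obtain n :: int where n: "0 \<le> n" "\<And>k. n \<le> \<bar>k\<bar> \<Longrightarrow> C + 2 * \<delta> + 2 * len g + 1 \<le> len (t [^] k)"
      using loxodromic_proper[OF t] by blast
    have far: "C + 2 * \<delta> < gp g (g \<otimes> t [^] (q * k)) (t [^] (p * k))" if "\<bar>k\<bar> = n" for k
    proof -
      have "t [^] (p * k) = g \<otimes> t [^] (q * k) \<otimes> inv g"
        using int_pow_conj[of g "t [^] q" k] int_pow_pow[of t p k] unfolding eq
        by (simp add: int_pow_pow)
      then have "g \<otimes> t [^] (q * k) = t [^] (p * k) \<otimes> g"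
        by (simp add: m_assoc)
      then have "d (t [^] (p * k)) (g \<otimes> t [^] (q * k)) = len g"
        by (simp add: dist_mult_right)
      moreover have "d (t [^] (p * k)) g \<ge> len (t [^] (p * k)) - len g"
        using triangle[of \<one> g "t [^] (p * k)"] commute[of g] by (simp add: len_def)
      moreover have "n \<le> \<bar>p * k\<bar>"
        using mult_right_mono[of 1 "\<bar>p\<bar>" n] \<open>p \<noteq> 0\<close> n(1) that by (simp add: abs_mult)
      then have "C + 2 * \<delta> + 2 * len g + 1 \<le> len (t [^] (p * k))" by (rule n(2))
      moreover have "gp g (t [^] (p * k)) (t [^] (p * k)) \<le>
          gp g (g \<otimes> t [^] (q * k)) (t [^] (p * k)) + d (g \<otimes> t [^] (q * k)) (t [^] (p * k))"
        by (rule gp_change) simp_all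
      ultimately show ?thesis
        using gp_self[of "t [^] (p * k)" g] commute[of "t [^] (p * k)" "g \<otimes> t [^] (q * k)"] by simp
    qed
    show ?thesis
    proof (rule near_axis_of_ends[OF t g])
      show "0 \<le> q * n" using that n(1) by simp
      show "0 \<le> q * n" using that n(1) by simp
      show "C + 2 * \<delta> < gp g (g \<otimes> t [^] (q * n)) (t [^] (p * n))" using far[of n] n(1) by simp
      show "C + 2 * \<delta> < gp g (g \<otimes> t [^] (- (q * n))) (t [^] (- (p * n)))"
        using far[of "- n"] n(1) by simp
    qed
  qed
  show ?thesis
  proof (cases "0 \<le> q")
    case True
    then show ?thesis using * assms by blast
  next
    case False
    have tc: "t \<in> carrier G" using t by simp
    have "t [^] (- p) = g \<otimes> t [^] (- q) \<otimes> inv g"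
      unfolding int_pow_neg[OF tc] eq using tc by (simp add: inv_mult_group m_assoc)
    then show ?thesis using *[of "- p" "- q"] False \<open>p \<noteq> 0\<close> by simp
  qed
qed

end

section \<open>Acylindrical actions\<close>

text \<open>Of the geodesics only \<open>intermediate\<close> is kept. It provides the points inside
  a segment at which acylindricity is tested when no loxodromic element exists.\<close>

locale acylindrical_hyperbolic_action = group G + gromov_hyperbolic S d \<delta>
  for G (structure) and S :: "'s set" and d and \<delta> +
  fixes \<phi> :: "'a \<Rightarrow> 's \<Rightarrow> 's" and x0 :: 's
  assumes base [simp]: "x0 \<in> S"
    and act_closed [simp]: "\<lbrakk>g \<in> carrier G; x \<in> S\<rbrakk> \<Longrightarrow> \<phi> g x \<in> S"
    and act_one [simp]: "x \<in> S \<Longrightarrow> \<phi> \<one> x = x"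
    and act_mult: "\<lbrakk>g \<in> carrier G; h \<in> carrier G; x \<in> S\<rbrakk> \<Longrightarrow> \<phi> (g \<otimes> h) x = \<phi> g (\<phi> h x)"
    and isometry: "\<lbrakk>g \<in> carrier G; x \<in> S; y \<in> S\<rbrakk> \<Longrightarrow> d (\<phi> g x) (\<phi> g y) = d x y"
    and intermediate: "\<lbrakk>x \<in> S; y \<in> S; 0 \<le> s; s \<le> d x y\<rbrakk> \<Longrightarrow> \<exists>z\<in>S. d x z = s \<and> d z y = d x y - s"
    and acylindrical: "0 < \<epsilon> \<Longrightarrow> \<exists>R. \<exists>N::nat. \<forall>x\<in>S. \<forall>y\<in>S. R \<le> d x y \<longrightarrow>
      finite {g \<in> carrier G. d x (\<phi> g x) \<le> \<epsilon> \<and> d y (\<phi> g y) \<le> \<epsilon>} \<and>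
      card {g \<in> carrier G. d x (\<phi> g x) \<le> \<epsilon> \<and> d y (\<phi> g y) \<le> \<epsilon>} \<le> N"
begin

lemma gp_orbit:
  "gromov_product (\<lambda>g h. d (\<phi> g x0) (\<phi> h x0)) a b c = gp (\<phi> a x0) (\<phi> b x0) (\<phi> c x0)"
  by (simp add: gromov_product_def)

sublocale orb: acylindrical_group_metric G "\<lambda>g h. d (\<phi> g x0) (\<phi> h x0)" \<delta>
proof unfold_locales
  fix w x y z assume "w \<in> carrier G" "x \<in> carrier G" "y \<in> carrier G" "z \<in> carrier G"
  then show "min (gromov_product (\<lambda>g h. d (\<phi> g x0) (\<phi> h x0)) w x y)
      (gromov_product (\<lambda>g h. d (\<phi> g x0) (\<phi> h x0)) w y z) - \<delta>
    \<le> gromov_product (\<lambda>g h. d (\<phi> g x0) (\<phi> h x0)) w x z"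
    unfolding gp_orbit by (intro four_point) simp_all
next
  show "d (\<phi> (a \<otimes> b) x0) (\<phi> (a \<otimes> c) x0) = d (\<phi> b x0) (\<phi> c x0)"
    if "a \<in> carrier G" "b \<in> carrier G" "c \<in> carrier G" for a b c
    using that by (simp add: act_mult isometry)
next
  fix \<epsilon> :: real assume "0 < \<epsilon>"
  from acylindrical[OF this] obtain R and N :: nat where
    RN: "\<forall>x\<in>S. \<forall>y\<in>S. R \<le> d x y \<longrightarrow>
      finite {g \<in> carrier G. d x (\<phi> g x) \<le> \<epsilon> \<and> d y (\<phi> g y) \<le> \<epsilon>} \<and>
      card {g \<in> carrier G. d x (\<phi> g x) \<le> \<epsilon> \<and> d y (\<phi> g y) \<le> \<epsilon>} \<le> N"
    by (elim exE)
  have "{e \<in> carrier G. d (\<phi> \<one> x0) (\<phi> e x0) \<le> \<epsilon> \<and> d (\<phi> x x0) (\<phi> (e \<otimes> x) x0) \<le> \<epsilon>} =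
      {g \<in> carrier G. d x0 (\<phi> g x0) \<le> \<epsilon> \<and> d (\<phi> x x0) (\<phi> g (\<phi> x x0)) \<le> \<epsilon>}"
    if "x \<in> carrier G" for x
    using that by (auto simp: act_mult)
  then show "\<exists>R. \<exists>N::nat. \<forall>x\<in>carrier G. R \<le> d (\<phi> \<one> x0) (\<phi> x x0) \<longrightarrow>
    finite {e \<in> carrier G. d (\<phi> \<one> x0) (\<phi> e x0) \<le> \<epsilon> \<and> d (\<phi> x x0) (\<phi> (e \<otimes> x) x0) \<le> \<epsilon>} \<and>
    card {e \<in> carrier G. d (\<phi> \<one> x0) (\<phi> e x0) \<le> \<epsilon> \<and> d (\<phi> x x0) (\<phi> (e \<otimes> x) x0) \<le> \<epsilon>} \<le> N"
    using RN by (intro exI[of _ R] exI[of _ N]) simp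
qed (use dist_self triangle nonneg commute delta_nonneg in auto)

lemma len_eq: "orb.len g = d x0 (\<phi> g x0)"
  by (simp add: orb.len_def)

lemma dist_inv: "\<lbrakk>g \<in> carrier G; x \<in> S; y \<in> S\<rbrakk> \<Longrightarrow> d (\<phi> (inv g) x) y = d x (\<phi> g y)"
  using isometry[of g "\<phi> (inv g) x" y] by (simp flip: act_mult)

text \<open>In the absence of loxodromic elements the orbit is horospherical: an element of small
  length moves every point deep on the segment towards a far orbit point by a bounded amount.\<close>

lemma deep_displacement:
  assumes gpH: "\<And>a b. \<lbrakk>a \<in> H; b \<in> H\<rbrakk> \<Longrightarrow>
      min (d x0 (\<phi> a x0)) (d x0 (\<phi> b x0)) / 2 - C \<le> gp x0 (\<phi> a x0) (\<phi> b x0)"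
    and H: "subgroup H G" and "0 \<le> C" and gH: "g \<in> H" and hH: "h \<in> H"
    and y [simp]: "y \<in> S" and ys: "d x0 y = s" "d y (\<phi> h x0) = d x0 (\<phi> h x0) - s"
    and r: "d x0 (\<phi> g x0) \<le> r" "r \<le> s" "2 * s \<le> d x0 (\<phi> h x0)"
  shows "d y (\<phi> g y) \<le> 6 * C + 6 * \<delta>"
proof -
  have [simp]: "g \<in> carrier G" "h \<in> carrier G" using H gH hH by (auto dest: subgroup.mem_carrier)
  define f where "f = inv g"
  have fH: "f \<in> H" and fhH: "g \<otimes> h \<in> H"
    using H gH hH by (simp_all add: f_def subgroup.m_inv_closed subgroup.m_closed)
  have [simp]: "f \<in> carrier G" by (simp add: f_def)
  define lg where "lg = d x0 (\<phi> g x0)"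
  define L where "L = d x0 (\<phi> h x0)"
  define L' where "L' = d x0 (\<phi> (g \<otimes> h) x0)"
  have flg: "d x0 (\<phi> f x0) = lg" using dist_inv[of g x0 x0] commute[of x0 "\<phi> (inv g) x0"] by (simp add: f_def lg_def)
  have fL: "d (\<phi> f x0) (\<phi> h x0) = L'" by (simp add: f_def L'_def dist_inv act_mult)
  have fy: "d (\<phi> f x0) y = d x0 (\<phi> g y)" by (simp add: f_def dist_inv)
  have "lg \<le> L" "0 \<le> lg" "0 \<le> L" using r nonneg by (simp_all add: lg_def L_def) (smt (verit) nonneg)+
  have yh: "gp x0 y (\<phi> h x0) = s"
    using gp_double[of x0 y "\<phi> h x0"] ys commute[of x0 y] commute[of x0 "\<phi> h x0"] by simp
  have "gp x0 (\<phi> f x0) (\<phi> h x0) \<ge> lg / 2 - C"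
    using gpH[OF fH hH] flg \<open>lg \<le> L\<close> by (simp add: L_def)
  then have "gp x0 (\<phi> f x0) y \<ge> lg / 2 - C - \<delta>"
    using four_point[of x0 "\<phi> f x0" "\<phi> h x0" y] yh gp_commute[of x0 y "\<phi> h x0"] r \<open>0 \<le> C\<close> \<open>0 \<le> lg\<close>
    by (simp add: lg_def)
  \<comment> \<open>The factor one half in \<open>gpH\<close> makes twice the product cancel the
    length \<open>lg\<close>, so moving \<open>y\<close> by \<open>g\<close> gains only a bounded
    height above \<open>s\<close>.\<close>
  then have up: "d x0 (\<phi> g y) \<le> s + 2 * C + 2 * \<delta>"
    using gp_double[of x0 "\<phi> f x0" y] fy flg ys(1) commute[of x0 y] commute[of x0 "\<phi> f x0"] by simp
  have "L' \<ge> L - lg"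
    using triangle[of x0 "\<phi> f x0" "\<phi> h x0"] fL flg by (simp add: L_def)
  then have "lg \<le> L'" using r by (simp add: L_def lg_def)
  have "gp (\<phi> f x0) x0 (\<phi> h x0) = gp x0 (\<phi> g x0) (\<phi> (g \<otimes> h) x0)"
  proof -
    have "d (\<phi> g x0) (\<phi> (g \<otimes> h) x0) = L" by (simp add: act_mult isometry L_def)
    then show ?thesis
      using gp_double[of "\<phi> f x0" x0 "\<phi> h x0"] gp_double[of x0 "\<phi> g x0" "\<phi> (g \<otimes> h) x0"]
        fL flg commute[of "\<phi> h x0" "\<phi> f x0"] commute[of x0 "\<phi> g x0"]
        commute[of x0 "\<phi> (g \<otimes> h) x0"]
      unfolding L'_def lg_def L_def by linarith
  qed
  then have "gp (\<phi> f x0) x0 (\<phi> h x0) \<ge> lg / 2 - C"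
    using gpH[OF gH fhH] \<open>lg \<le> L'\<close> by (simp add: lg_def L'_def)
  then have L': "L' \<ge> L - 2 * C"
    using gp_double[of "\<phi> f x0" x0 "\<phi> h x0"] fL flg commute[of "\<phi> h x0" "\<phi> f x0"] by (simp add: L_def)
  have gyh: "d (\<phi> g y) (\<phi> (g \<otimes> h) x0) = L - s"
    using ys(2) by (simp add: act_mult isometry L_def)
  have low: "d x0 (\<phi> g y) \<ge> s - 2 * C"
    using triangle[of x0 "\<phi> g y" "\<phi> (g \<otimes> h) x0"] gyh L' by (simp add: L'_def)
  have 1: "gp x0 (\<phi> g y) (\<phi> (g \<otimes> h) x0) \<ge> s - 2 * C"
    using gp_double[of x0 "\<phi> g y" "\<phi> (g \<otimes> h) x0"] gyh low L'
      commute[of x0 "\<phi> g y"] commute[of x0 "\<phi> (g \<otimes> h) x0"] by (simp add: L'_def)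
  \<comment> \<open>The product is about half of \<open>L\<close>, and \<open>2 * s \<le> L\<close>
    makes this at least \<open>s\<close> up to a constant.\<close>
  have 2: "gp x0 (\<phi> (g \<otimes> h) x0) (\<phi> h x0) \<ge> s - 2 * C"
    using gpH[OF fhH hH] L' r \<open>0 \<le> C\<close> by (simp add: L'_def L_def min_def split: if_splits)
  have 3: "gp x0 (\<phi> g y) (\<phi> h x0) \<ge> s - 2 * C - \<delta>"
    using four_point[of x0 "\<phi> g y" "\<phi> (g \<otimes> h) x0" "\<phi> h x0"] 1 2 by simp
  \<comment> \<open>Both \<open>y\<close> and its image are at distance about \<open>s\<close> from
    \<open>x0\<close>, with a product also about \<open>s\<close>; hence they are close.\<close>
  have "gp x0 (\<phi> g y) y \<ge> s - 2 * C - 2 * \<delta>"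
    using four_point[of x0 "\<phi> g y" "\<phi> h x0" y] 3 yh gp_commute[of x0 y "\<phi> h x0"]
      \<open>0 \<le> C\<close> delta_nonneg by simp
  then show ?thesis
    using gp_double[of x0 "\<phi> g y" y] up ys(1) commute[of y x0] commute[of "\<phi> g y" x0]
      commute[of "\<phi> g y" y] by simp
qed

text \<open>Otherwise any \<open>N + 1\<close> elements of \<open>H\<close> would, by
  \<open>deep_displacement\<close>, barely move two points at distance at least \<open>R\<close> on
  the segment towards a sufficiently far orbit point, against acylindricity.\<close>

lemma loxodromic_if_unbounded:
  assumes H: "subgroup H G" and unb: "\<And>B. \<exists>h\<in>H. B < d x0 (\<phi> h x0)"
  shows "\<exists>t\<in>H. \<exists>C. orb.loxodromic C t"
proof (rule ccontr)
  assume "\<not> ?thesis"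
  then have no_lox: "\<not> orb.loxodromic C t" if "t \<in> H" for t C using that by blast
  define C where "C = 4 * \<delta> + 1"
  have "0 \<le> C" using delta_nonneg by (simp add: C_def)
  have gpH: "min (d x0 (\<phi> a x0)) (d x0 (\<phi> b x0)) / 2 - C \<le> gp x0 (\<phi> a x0) (\<phi> b x0)"
    if "a \<in> H" "b \<in> H" for a b
    using orb.gp_ge_if_no_loxodromic[OF H no_lox that] by (simp add: gp_orbit len_eq C_def)
  define \<epsilon> where "\<epsilon> = 6 * C + 6 * \<delta> + 1"
  have "0 < \<epsilon>" using \<open>0 \<le> C\<close> delta_nonneg by (simp add: \<epsilon>_def)
  from acylindrical[OF this] obtain R and N :: nat where
    RN: "\<forall>x\<in>S. \<forall>y\<in>S. R \<le> d x y \<longrightarrow>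
      finite {g \<in> carrier G. d x (\<phi> g x) \<le> \<epsilon> \<and> d y (\<phi> g y) \<le> \<epsilon>} \<and>
      card {g \<in> carrier G. d x (\<phi> g x) \<le> \<epsilon> \<and> d y (\<phi> g y) \<le> \<epsilon>} \<le> N"
    by (elim exE)
  have "infinite H"
  proof
    assume "finite H"
    then have "d x0 (\<phi> h x0) \<le> Max ((\<lambda>h. d x0 (\<phi> h x0)) ` H)" if "h \<in> H" for h using that by simp
    then show False using unb[of "Max ((\<lambda>h. d x0 (\<phi> h x0)) ` H)"] by force
  qed
  then obtain F where F: "finite F" "card F = Suc N" "F \<subseteq> H"
    by (meson infinite_arbitrarily_large)
  define r where "r = Max ((\<lambda>h. d x0 (\<phi> h x0)) ` F)"
  have r: "d x0 (\<phi> g x0) \<le> r" if "g \<in> F" for g using that F(1) by (simp add: r_def)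
  have "F \<noteq> {}" using F(2) by auto
  then have "0 \<le> r" using r nonneg order_trans by blast
  obtain h where h: "h \<in> H" "2 * (r + \<bar>R\<bar>) < d x0 (\<phi> h x0)" using unb by blast
  have [simp]: "h \<in> carrier G" using H h(1) by (rule subgroup.mem_carrier)
  have rL: "r + \<bar>R\<bar> \<le> d x0 (\<phi> h x0)" 
    using h(2) \<open>0 \<le> r\<close> abs_ge_zero[of R] by argo
  obtain y where y: "y \<in> S" "d x0 y = r" "d y (\<phi> h x0) = d x0 (\<phi> h x0) - r"
    using intermediate[of x0 "\<phi> h x0" r] rL \<open>0 \<le> r\<close> abs_ge_zero[of R] by auto
  obtain z where z: "z \<in> S" "d x0 z = r + \<bar>R\<bar>" "d z (\<phi> h x0) = d x0 (\<phi> h x0) - (r + \<bar>R\<bar>)"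
    using intermediate[of x0 "\<phi> h x0" "r + \<bar>R\<bar>"] rL \<open>0 \<le> r\<close> by auto
  have "R \<le> d y z" using triangle[of x0 y z] y z by simp
  define E where "E = {g \<in> carrier G. d y (\<phi> g y) \<le> \<epsilon> \<and> d z (\<phi> g z) \<le> \<epsilon>}"
  have E: "finite E" "card E \<le> N" using RN y(1) z(1) \<open>R \<le> d y z\<close> by (simp_all add: E_def)
  have "F \<subseteq> E"
  proof
    fix g assume g: "g \<in> F"
    then have gH: "g \<in> H" using F(3) by blast
    have "d y (\<phi> g y) \<le> 6 * C + 6 * \<delta>"
      using h(2) \<open>0 \<le> r\<close> by (intro deep_displacement[OF gpH H \<open>0 \<le> C\<close> gH h(1) y r[OF g]]) auto
    moreover have "d z (\<phi> g z) \<le> 6 * C + 6 * \<delta>"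
      using h(2) \<open>0 \<le> r\<close> by (intro deep_displacement[OF gpH H \<open>0 \<le> C\<close> gH h(1) z r[OF g]]) auto
    ultimately show "g \<in> E"
      using subgroup.mem_carrier[OF H gH] by (simp add: E_def \<epsilon>_def)
  qed
  then show False using card_mono[OF E(1), of F] E(2) F(2) by simp
qed

end

section \<open>Limit sets\<close>

context gromov_hyperbolic
begin

text \<open>Changing the base point from \<open>w\<close> to \<open>v\<close> costs at most
  \<open>d v w\<close>, so one base point decides.\<close>

lemma gromov_joint_iff:
  assumes "w \<in> M" "range x \<subseteq> M" "range y \<subseteq> M"
  shows "gromov_joint M d x y \<longleftrightarrow> (\<forall>B. \<exists>n. \<forall>i\<ge>n. \<forall>j\<ge>n. B \<le> gp w (x i) (y j))"
proof -
  have *: "filterlim (\<lambda>(i, j). gp v (x i) (y j)) at_top (sequentially \<times>\<^sub>F sequentially) \<longleftrightarrow>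
      (\<forall>B. \<exists>n. \<forall>i\<ge>n. \<forall>j\<ge>n. B \<le> gp v (x i) (y j))" for v
    unfolding filterlim_at_top eventually_prod_sequentially by (simp, blast)
  have "\<forall>B. \<exists>n. \<forall>i\<ge>n. \<forall>j\<ge>n. B \<le> gp v (x i) (y j)"
    if "v \<in> M" and lim: "\<forall>B. \<exists>n. \<forall>i\<ge>n. \<forall>j\<ge>n. B \<le> gp w (x i) (y j)" for v
  proof
    fix B
    obtain n where n: "\<forall>i\<ge>n. \<forall>j\<ge>n. B + d v w \<le> gp w (x i) (y j)" using lim by blast
    have "B \<le> gp v (x i) (y j)" if "n \<le> i" "n \<le> j" for i j
    proof -
      have "gp w (x i) (y j) \<le> gp v (x i) (y j) + d v w"
        using assms \<open>v \<in> M\<close> by (intro gp_change_base) auto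
      then show ?thesis using n that by fastforce
    qed
    then show "\<exists>n. \<forall>i\<ge>n. \<forall>j\<ge>n. B \<le> gp v (x i) (y j)" by blast
  qed
  then show ?thesis unfolding gromov_joint_def * using assms(1) by blast
qed

lemma gromov_joint_sym: "gromov_joint M d x y \<Longrightarrow> range x \<subseteq> M \<Longrightarrow> range y \<subseteq> M \<Longrightarrow> gromov_joint M d y x"
proof -
  assume joint: "gromov_joint M d x y" and xy: "range x \<subseteq> M" "range y \<subseteq> M"
  then have w: "x 0 \<in> M" by blast
  show ?thesis
    unfolding gromov_joint_iff[OF w xy(2,1)]
  proof
    fix B
    obtain n where "\<forall>i\<ge>n. \<forall>j\<ge>n. B \<le> gp (x 0) (x i) (y j)"
      using joint unfolding gromov_joint_iff[OF w xy] by blast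
    then show "\<exists>n. \<forall>i\<ge>n. \<forall>j\<ge>n. B \<le> gp (x 0) (y i) (x j)"
      unfolding gp_commute[of "x 0" "y _"] by blast
  qed
qed

lemma gromov_joint_trans:
  assumes "gromov_joint M d x y" "gromov_joint M d y z"
    and xyz: "range x \<subseteq> M" "range y \<subseteq> M" "range z \<subseteq> M"
  shows "gromov_joint M d x z"
proof -
  have w: "x 0 \<in> M" using xyz by blast
  show ?thesis
    unfolding gromov_joint_iff[OF w xyz(1,3)]
  proof
    fix B
    obtain n where n: "\<forall>i\<ge>n. \<forall>j\<ge>n. B + \<delta> \<le> gp (x 0) (x i) (y j)"
      using assms(1) unfolding gromov_joint_iff[OF w xyz(1,2)] by blast
    obtain m where m: "\<forall>i\<ge>m. \<forall>j\<ge>m. B + \<delta> \<le> gp (x 0) (y i) (z j)"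
      using assms(2) unfolding gromov_joint_iff[OF w xyz(2,3)] by blast
    have "B \<le> gp (x 0) (x i) (z j)" if "max n m \<le> i" "max n m \<le> j" for i j
    proof -
      have "B + \<delta> \<le> gp (x 0) (x i) (y i)" "B + \<delta> \<le> gp (x 0) (y i) (z j)"
        using n m that by simp_all
      moreover have "min (gp (x 0) (x i) (y i)) (gp (x 0) (y i) (z j)) - \<delta> \<le> gp (x 0) (x i) (z j)"
        using w xyz by (intro four_point) auto
      ultimately show ?thesis by linarith
    qed
    then show "\<exists>n. \<forall>i\<ge>n. \<forall>j\<ge>n. B \<le> gp (x 0) (x i) (z j)" by blast
  qed
qed

text \<open>The relation by which \<open>gromov_boundary\<close> is a quotient, named so that the
  library facts on equivalence classes apply.\<close>

definition joint_rel :: "((nat \<Rightarrow> 's) \<times> (nat \<Rightarrow> 's)) set" where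
  "joint_rel = {(x, y). x \<in> converging_at_infinity M d \<and> y \<in> converging_at_infinity M d \<and>
     gromov_joint M d x y}"

lemma equiv_joint_rel: "equiv (converging_at_infinity M d) joint_rel"
proof (rule equivI)
  show "joint_rel \<subseteq> converging_at_infinity M d \<times> converging_at_infinity M d"
    by (auto simp: joint_rel_def)
  show "refl_on (converging_at_infinity M d) joint_rel"
    by (auto simp: refl_on_def joint_rel_def converging_at_infinity_def)
  show "sym joint_rel"
    by (auto simp: sym_def joint_rel_def converging_at_infinity_def intro: gromov_joint_sym)
  show "trans joint_rel"
    unfolding trans_def joint_rel_def converging_at_infinity_def
    using gromov_joint_trans by blast
qed

lemma boundary_class_eq_iff:
  assumes "x \<in> converging_at_infinity M d" "y \<in> converging_at_infinity M d"
  shows "joint_rel `` {x} = joint_rel `` {y} \<longleftrightarrow> gromov_joint M d x y"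
  using eq_equiv_class_iff[OF equiv_joint_rel assms] assms by (simp add: joint_rel_def)

lemma accumulation_points_eq:
  "accumulation_points_at_infinity M d A =
    {joint_rel `` {x} | x. x \<in> converging_at_infinity M d \<and> range x \<subseteq> A}" (is "?L = ?R")
proof
  show "?L \<subseteq> ?R"
  proof
    fix \<xi> assume "\<xi> \<in> ?L"
    then obtain x where "\<xi> \<in> converging_at_infinity M d // joint_rel" "x \<in> \<xi>" "range x \<subseteq> A"
      by (auto simp: accumulation_points_at_infinity_def gromov_boundary_def joint_rel_def)
    moreover then have "x \<in> converging_at_infinity M d"
      using in_quotient_imp_subset[OF equiv_joint_rel] by blast
    moreover have "\<xi> = joint_rel `` {x}"
      using calculation by (metis Image_singleton_iff equiv_class_eq equiv_joint_rel quotientE)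
    ultimately show "\<xi> \<in> ?R" by blast
  qed
  show "?R \<subseteq> ?L"
  proof
    fix \<xi> assume "\<xi> \<in> ?R"
    then obtain x where x: "\<xi> = joint_rel `` {x}" "x \<in> converging_at_infinity M d" "range x \<subseteq> A"
      by blast
    then have "\<xi> \<in> converging_at_infinity M d // joint_rel" by (simp add: quotientI)
    moreover have "x \<in> \<xi>" using x equiv_class_self[OF equiv_joint_rel] by blast
    ultimately show "\<xi> \<in> ?L"
      using x(3) unfolding accumulation_points_at_infinity_def gromov_boundary_def joint_rel_def by blast
  qed
qed

end

section \<open>Limit sets of subgroups and the ends of axes\<close>

context acylindrical_hyperbolic_action
begin

lemma limit_set_eq:
  assumes "H \<subseteq> carrier G"
  shows "limit_set (G\<lparr>carrier := H\<rparr>) S d \<phi> =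
    {joint_rel `` {x} | x. x \<in> converging_at_infinity S d \<and> (\<exists>s\<in>S. \<forall>i. \<exists>h\<in>H. x i = \<phi> h s)}"
proof -
  have "range x \<subseteq> {\<phi> g s |g. g \<in> carrier (G\<lparr>carrier := H\<rparr>)} \<longleftrightarrow> (\<forall>i. \<exists>h\<in>H. x i = \<phi> h s)"
    for x :: "nat \<Rightarrow> 's" and s
    by (auto simp: image_subset_iff Bex_def conj_commute)
  then show ?thesis
    unfolding limit_set_def accumulation_points_eq orbit_def by blast
qed

text \<open>One end of the axis of \<open>t\<close> translated by \<open>h\<close>; the other end is
  \<open>ray h (inv t)\<close>.\<close>

definition ray :: "'a \<Rightarrow> 'a \<Rightarrow> nat \<Rightarrow> 's" where
  "ray h t m = \<phi> (h \<otimes> t [^] int m) x0"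

lemma range_ray: "\<lbrakk>h \<in> carrier G; t \<in> carrier G\<rbrakk> \<Longrightarrow> range (ray h t) \<subseteq> S"
  by (auto simp: ray_def)

lemma gp_powers_ge:
  fixes i j :: int
  assumes t: "orb.loxodromic C t" and "0 \<le> i" "0 \<le> j"
  shows "min (orb.len (t [^] i)) (orb.len (t [^] j)) - C \<le> orb.gp \<one> (t [^] i) (t [^] j)"
proof -
  have *: "orb.len (t [^] i) - C \<le> orb.gp \<one> (t [^] i) (t [^] j)" if "0 \<le> i" "i \<le> j" for i j :: int
    using orb.gp_add[of \<one> "t [^] i" "t [^] j"] orb.loxodromic_between[OF t that]
    by (simp add: orb.len_def)
  show ?thesis
    using *[of i j] *[of j i] orb.gp_commute[of \<one> "t [^] i" "t [^] j"] assms(2,3)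
    by (cases "i \<le> j") linarith+
qed

lemma ray_converges:
  assumes t: "orb.loxodromic C t" and h [simp]: "h \<in> carrier G"
  shows "ray h t \<in> converging_at_infinity S d"
proof -
  have tc [simp]: "t \<in> carrier G" using t by simp
  have r: "range (ray h t) \<subseteq> S" by (rule range_ray) simp_all
  have w: "\<phi> h x0 \<in> S" by simp
  have "gromov_joint S d (ray h t) (ray h t)"
    unfolding gromov_joint_iff[OF w r r]
  proof
    fix B
    obtain n :: int where n: "0 \<le> n" "\<And>k. n \<le> \<bar>k\<bar> \<Longrightarrow> B + C \<le> orb.len (t [^] k)"
      using orb.loxodromic_proper[OF t] by blast
    have "B \<le> gp (\<phi> h x0) (ray h t i) (ray h t j)" if "nat n \<le> i" "nat n \<le> j" for i j
    proof -
      have "B + C \<le> orb.len (t [^] int i)" "B + C \<le> orb.len (t [^] int j)"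
        using that n(1) by (auto intro!: n(2))
      then have "B \<le> orb.gp \<one> (t [^] int i) (t [^] int j)"
        using gp_powers_ge[OF t, of "int i" "int j"] by simp
      also have "\<dots> = orb.gp h (h \<otimes> t [^] int i) (h \<otimes> t [^] int j)"
        using orb.gp_left_invariant[of h \<one> "t [^] int i" "t [^] int j"] by simp
      finally show ?thesis by (simp add: gp_orbit ray_def)
    qed
    then show "\<exists>n. \<forall>i\<ge>n. \<forall>j\<ge>n. B \<le> gp (\<phi> h x0) (ray h t i) (ray h t j)" by blast
  qed
  with r show ?thesis by (simp add: converging_at_infinity_def)
qed

lemma opposite_rays_not_joint:
  assumes t: "orb.loxodromic C t" and h [simp]: "h \<in> carrier G"
  shows "\<not> gromov_joint S d (ray h t) (ray h (inv t))"
proof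
  have tc [simp]: "t \<in> carrier G" using t by simp
  have w: "\<phi> h x0 \<in> S" by simp
  assume "gromov_joint S d (ray h t) (ray h (inv t))"
  then have "\<forall>B. \<exists>n. \<forall>i\<ge>n. \<forall>j\<ge>n. B \<le> gp (\<phi> h x0) (ray h t i) (ray h (inv t) j)"
    using gromov_joint_iff[OF w range_ray[of h t] range_ray[of h "inv t"]] by simp
  then obtain n where "\<forall>i\<ge>n. \<forall>j\<ge>n. C + 1 \<le> gp (\<phi> h x0) (ray h t i) (ray h (inv t) j)"
    by blast
  then have "C + 1 \<le> orb.gp h (h \<otimes> t [^] int n) (h \<otimes> t [^] (- int n))"
    by (simp add: ray_def gp_orbit int_pow_inv int_pow_neg)
  also have "\<dots> = orb.gp \<one> (t [^] int n) (t [^] (- int n))"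
    using orb.gp_left_invariant[of h \<one> "t [^] int n" "t [^] (- int n)"] by simp
  also have "\<dots> \<le> C"
    using orb.loxodromic_between[OF t, of "- int n" 0 "int n"]
      orb.gp_commute[of \<one> "t [^] int n" "t [^] (- int n)"] by simp
  finally show False by simp
qed

text \<open>The two ends of the axis of \<open>t\<close> already exhaust the limit set. The ends of
  its translate by \<open>h\<close> are limit points of \<open>H\<close> too, so each is one of
  these two, and \<open>near_axis_of_ends\<close> applies at \<open>h\<close>.\<close>

lemma near_axis_if_limit_set_small:
  assumes H: "subgroup H G" and t: "orb.loxodromic C t" "t \<in> H"
    and small: "finite (limit_set (G\<lparr>carrier := H\<rparr>) S d \<phi>)" "card (limit_set (G\<lparr>carrier := H\<rparr>) S d \<phi>) \<le> 2"
    and h: "h \<in> H"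
  shows "\<exists>l::int. d (\<phi> h x0) (\<phi> (t [^] l) x0) \<le> orb.len t + 4 * C + 6 * \<delta>"
proof -
  have Hc: "H \<subseteq> carrier G" using H by (rule subgroup.subset)
  have [simp]: "t \<in> carrier G" "h \<in> carrier G" using Hc t(2) h by blast+
  note ti = orb.loxodromic_inv[OF t(1)]
  define \<Lambda> where "\<Lambda> = limit_set (G\<lparr>carrier := H\<rparr>) S d \<phi>"
  define cl where "cl x = joint_rel `` {x}" for x
  have memb: "cl (ray a b) \<in> \<Lambda>" if "a \<in> H" "b \<in> H" "orb.loxodromic C b" for a b
  proof -
    have "\<exists>h\<in>H. ray a b i = \<phi> h x0" for i
      unfolding ray_def
      using that H subgroup_int_pow_closed[OF H] subgroup.m_closed[OF H] by blast
    then have "\<exists>s\<in>S. \<forall>i. \<exists>h\<in>H. ray a b i = \<phi> h s" using base by blast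
    moreover have "ray a b \<in> converging_at_infinity S d"
      using ray_converges[OF that(3)] that(1) Hc by blast
    ultimately show ?thesis unfolding \<Lambda>_def limit_set_eq[OF Hc] cl_def by blast
  qed
  have oneH: "\<one> \<in> H" and itH: "inv t \<in> H"
    using H t(2) by (simp_all add: subgroup.one_closed subgroup.m_inv_closed)
  have eq_iff: "cl (ray a b) = cl (ray a' b') \<longleftrightarrow> gromov_joint S d (ray a b) (ray a' b')"
    if "a \<in> carrier G" "a' \<in> carrier G" "orb.loxodromic C b" "orb.loxodromic C b'" for a b a' b'
    unfolding cl_def using that by (intro boundary_class_eq_iff ray_converges) auto
  have ne: "cl (ray a t) \<noteq> cl (ray a (inv t))" if "a \<in> carrier G" for a
    using eq_iff[of a a t "inv t"] opposite_rays_not_joint[OF t(1) that] that t(1) ti by simp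
  have "{cl (ray \<one> t), cl (ray \<one> (inv t))} \<subseteq> \<Lambda>"
    using memb oneH itH t ti by blast
  moreover have "card {cl (ray \<one> t), cl (ray \<one> (inv t))} = 2" using ne[of \<one>] by simp
  ultimately have \<Lambda>: "\<Lambda> = {cl (ray \<one> t), cl (ray \<one> (inv t))}"
    using card_seteq[of \<Lambda> "{cl (ray \<one> t), cl (ray \<one> (inv t))}"] small unfolding \<Lambda>_def by simp
  have "cl (ray h t) \<in> \<Lambda>" "cl (ray h (inv t)) \<in> \<Lambda>"
    using memb h itH t ti by blast+
  \<comment> \<open>Translation by \<open>h\<close> may exchange the two ends, so \<open>e\<close>
    and \<open>e'\<close> are left open.\<close>
  then have "\<exists>e e'. (e = t \<or> e = inv t) \<and> (e' = t \<or> e' = inv t) \<and>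
      cl (ray h t) = cl (ray \<one> e) \<and> cl (ray h (inv t)) = cl (ray \<one> e')"
    unfolding \<Lambda> by blast
  then obtain e e' where e: "e = t \<or> e = inv t" "e' = t \<or> e' = inv t"
    "gromov_joint S d (ray h t) (ray \<one> e)" "gromov_joint S d (ray h (inv t)) (ray \<one> e')"
    using eq_iff t(1) ti by (metis \<open>h \<in> carrier G\<close> one_closed)
  have pow: "\<exists>b::int. f [^] int m = t [^] b" if "f = t \<or> f = inv t" for f m
    using that by (auto simp: int_pow_inv simp flip: int_pow_neg)
  have close: "\<exists>(m::nat) b::int. C + 2 * \<delta> < orb.gp h (h \<otimes> c [^] int m) (t [^] b)"
    if joint: "gromov_joint S d (ray h c) (ray \<one> f)" and c: "c \<in> carrier G" and f: "f = t \<or> f = inv t" for c f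
  proof -
    have fc: "f \<in> carrier G" using f by auto
    have w: "\<phi> h x0 \<in> S" by simp
    have "\<forall>B. \<exists>n. \<forall>i\<ge>n. \<forall>j\<ge>n. B \<le> gp (\<phi> h x0) (ray h c i) (ray \<one> f j)"
      using joint gromov_joint_iff[OF w range_ray[of h c] range_ray[of \<one> f]] c fc by simp
    then obtain n where "\<forall>i\<ge>n. \<forall>j\<ge>n. C + 2 * \<delta> + 1 \<le> gp (\<phi> h x0) (ray h c i) (ray \<one> f j)"
      by blast
    then have "C + 2 * \<delta> + 1 \<le> orb.gp h (h \<otimes> c [^] int n) (f [^] int n)"
      using fc by (simp add: gp_orbit ray_def)
    moreover obtain b :: int where "f [^] int n = t [^] b" using pow[OF f] by blast
    ultimately show ?thesis by (intro exI[of _ n] exI[of _ b]) simp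
  qed
  obtain m :: nat and a :: int where m: "C + 2 * \<delta> < orb.gp h (h \<otimes> t [^] int m) (t [^] a)"
    using close[OF e(3) _ e(1)] by auto
  obtain m' :: nat and b :: int where m': "C + 2 * \<delta> < orb.gp h (h \<otimes> inv t [^] int m') (t [^] b)"
    using close[OF e(4) _ e(2)] by auto
  have "inv t [^] int m' = t [^] (- int m')" by (simp add: int_pow_inv int_pow_neg)
  then show ?thesis
    using orb.near_axis_of_ends[OF t(1) \<open>h \<in> carrier G\<close> _ _ m, of "int m'" b] m' by simp
qed

text \<open>The product of a point with itself is its distance from \<open>x0\<close>, so a sequence
  converging at infinity leaves every ball.\<close>

lemma limit_set_empty_if_bounded:
  assumes H: "H \<subseteq> carrier G" and bdd: "\<And>h. h \<in> H \<Longrightarrow> d x0 (\<phi> h x0) \<le> B"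
  shows "limit_set (G\<lparr>carrier := H\<rparr>) S d \<phi> = {}"
proof -
  have False
    if x: "x \<in> converging_at_infinity S d" and s: "s \<in> S" "\<forall>i. \<exists>h\<in>H. x i = \<phi> h s" for x s
  proof -
    have r: "range x \<subseteq> S" and "gromov_joint S d x x" using x by (simp_all add: converging_at_infinity_def)
    then obtain n where n: "\<forall>i\<ge>n. \<forall>j\<ge>n. B + d x0 s + 1 \<le> gp x0 (x i) (x j)"
      unfolding gromov_joint_iff[OF base r r] by blast
    obtain h where h: "h \<in> H" "x n = \<phi> h s" using s(2) by blast
    have [simp]: "h \<in> carrier G" using h H by blast
    have "B + d x0 s + 1 \<le> gp x0 (x n) (x n)" using n by simp
    also have "\<dots> = d x0 (\<phi> h s)" using gp_self[of "\<phi> h s" x0] s(1) commute[of x0 "\<phi> h s"] by (simp add: h(2))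
    also have "\<dots> \<le> d x0 (\<phi> h x0) + d (\<phi> h x0) (\<phi> h s)" using s(1) by (intro triangle) simp_all
    also have "\<dots> \<le> B + d x0 s" using bdd[OF h(1)] s(1) by (simp add: isometry)
    finally show False by simp
  qed
  then show ?thesis unfolding limit_set_eq[OF H] by blast
qed

text \<open>A convergent sequence in an orbit is tracked by powers \<open>t [^] l i\<close>. Powers
  on opposite sides of \<open>\<one>\<close> have product at most \<open>C\<close>, so eventually
  all \<open>l i\<close> lie on one side, and the sequence tends to that end.\<close>

lemma limit_set_small_if_near_axis:
  assumes H: "H \<subseteq> carrier G" and t: "orb.loxodromic C t"
    and near: "\<And>h. h \<in> H \<Longrightarrow> \<exists>l::int. d (\<phi> h x0) (\<phi> (t [^] l) x0) \<le> D"
  shows "limit_set (G\<lparr>carrier := H\<rparr>) S d \<phi> \<subseteq> {joint_rel `` {ray \<one> t}, joint_rel `` {ray \<one> (inv t)}}"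
proof -
  have tc [simp]: "t \<in> carrier G" using t by simp
  note ti = orb.loxodromic_inv[OF t]
  have "gromov_joint S d x (ray \<one> t) \<or> gromov_joint S d x (ray \<one> (inv t))"
    if x: "x \<in> converging_at_infinity S d" and s: "s \<in> S" "\<forall>i. \<exists>h\<in>H. x i = \<phi> h s" for x s
  proof -
    define D' where "D' = D + d s x0"
    have r: "range x \<subseteq> S" and joint: "gromov_joint S d x x"
      using x by (simp_all add: converging_at_infinity_def)
    have xS [simp]: "x i \<in> S" for i using r by blast
    have "\<exists>l::int. d (x i) (\<phi> (t [^] l) x0) \<le> D'" for i
    proof -
      obtain h where h: "h \<in> H" "x i = \<phi> h s" using s(2) by blast
      have [simp]: "h \<in> carrier G" using h H by blast
      obtain l :: int where l: "d (\<phi> h x0) (\<phi> (t [^] l) x0) \<le> D" using near[OF h(1)] by blast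
      have "d (\<phi> h s) (\<phi> (t [^] l) x0) \<le> d (\<phi> h s) (\<phi> h x0) + d (\<phi> h x0) (\<phi> (t [^] l) x0)"
        using s(1) by (intro triangle) simp_all
      then show ?thesis using l s(1) by (intro exI[of _ l]) (simp add: h(2) isometry D'_def)
    qed
    then obtain l :: "nat \<Rightarrow> int" where l: "\<And>i. d (x i) (\<phi> (t [^] l i) x0) \<le> D'" by metis
    have near_gp: "\<bar>gp x0 (x i) y - gp x0 (\<phi> (t [^] l i) x0) y\<bar> \<le> D'" if "y \<in> S" for i y
      using gp_change[of x0 "x i" "\<phi> (t [^] l i) x0" y] gp_change[of x0 "\<phi> (t [^] l i) x0" "x i" y]
        l[of i] commute[of "x i" "\<phi> (t [^] l i) x0"] that by simp
    obtain n where n: "\<forall>i\<ge>n. \<forall>j\<ge>n. C + 2 * D' + 1 \<le> gp x0 (x i) (x j)"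
      using joint unfolding gromov_joint_iff[OF base r r] by blast
    have same: "0 \<le> l i \<and> 0 \<le> l j \<or> l i \<le> 0 \<and> l j \<le> 0" if "n \<le> i" "n \<le> j" for i j
    proof -
      have False if "n \<le> i" "n \<le> j" "l i \<le> 0" "0 \<le> l j" for i j
      proof -
        have "gp x0 (\<phi> (t [^] l i) x0) (\<phi> (t [^] l j) x0) \<le> C"
          using orb.loxodromic_between[OF t that(3,4)] by (simp add: gp_orbit)
        moreover have "C + 2 * D' + 1 \<le> gp x0 (x i) (x j)" using n that by blast
        ultimately show False
          using near_gp[of "x j" i] near_gp[of "\<phi> (t [^] l i) x0" j]
            gp_commute[of x0 "x j" "\<phi> (t [^] l i) x0"]
            gp_commute[of x0 "\<phi> (t [^] l j) x0" "\<phi> (t [^] l i) x0"] by simp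
      qed
      from this[of i j] this[of j i] that show ?thesis
        by (cases "0 \<le> l i"; cases "0 \<le> l j") auto
    qed
    \<comment> \<open>Both signs at once: \<open>e = t\<close> with \<open>k = l\<close>, and
      \<open>e = inv t\<close> with \<open>k i = - l i\<close>.\<close>
    have joint_ray: "gromov_joint S d x (ray \<one> e)"
      if e: "orb.loxodromic C e" and k: "\<And>i. n \<le> i \<Longrightarrow> 0 \<le> k i" "\<And>i. n \<le> i \<Longrightarrow> t [^] l i = e [^] k i"
      for e and k :: "nat \<Rightarrow> int"
    proof -
      have ec [simp]: "e \<in> carrier G" using e by simp
      show ?thesis
        unfolding gromov_joint_iff[OF base r range_ray[OF one_closed ec]]
      proof
        fix B
        obtain p :: int where p: "0 \<le> p" "\<And>k. p \<le> \<bar>k\<bar> \<Longrightarrow> B + C + D' \<le> orb.len (e [^] k)"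
          using orb.loxodromic_proper[OF e] by blast
        obtain q where q: "\<forall>i\<ge>q. \<forall>j\<ge>q. B + C + 2 * D' \<le> gp x0 (x i) (x j)"
          using joint unfolding gromov_joint_iff[OF base r r] by blast
        have "B \<le> gp x0 (x i) (ray \<one> e j)" if ij: "max n (max (nat p) q) \<le> i" "max n (max (nat p) q) \<le> j" for i j
        proof -
          have "B + C + 2 * D' \<le> gp x0 (x i) (x i)" using q ij by simp
          then have "B + C + 2 * D' \<le> d (x i) x0" using gp_self[of "x i" x0] by simp
          then have "B + C + D' \<le> orb.len (e [^] k i)"
            using triangle[of "x i" "\<phi> (t [^] l i) x0" x0] l[of i] k(2)[of i] ij
              commute[of x0 "\<phi> (t [^] l i) x0"] by (simp add: len_eq)
          moreover have "B + C + D' \<le> orb.len (e [^] int j)"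
            using ij p(1) by (intro p(2)) (simp add: nat_le_iff)
          ultimately have "B + D' \<le> orb.gp \<one> (e [^] k i) (e [^] int j)"
            using gp_powers_ge[OF e, of "k i" "int j"] k(1)[of i] ij by simp
          then have "B + D' \<le> gp x0 (\<phi> (t [^] l i) x0) (ray \<one> e j)"
            using k(2)[of i] ij by (simp add: gp_orbit ray_def)
          then show ?thesis
            using near_gp[of "ray \<one> e j" i] range_ray[of \<one> e] by (simp add: ray_def)
        qed
        then show "\<exists>n. \<forall>i\<ge>n. \<forall>j\<ge>n. B \<le> gp x0 (x i) (ray \<one> e j)" by blast
      qed
    qed
    show ?thesis
    proof (cases "\<forall>i\<ge>n. 0 \<le> l i")
      case True
      then show ?thesis using joint_ray[OF t, of l] by simp
    next
      case False
      then obtain i where "n \<le> i" "l i < 0" by auto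
      then have "l j \<le> 0" if "n \<le> j" for j using same[of i j] that by auto
      moreover have "t [^] k = inv t [^] (- k)" for k :: int
        by (simp add: int_pow_inv int_pow_neg)
      ultimately show ?thesis using joint_ray[OF ti, of "\<lambda>i. - l i"] by simp
    qed
  qed
  then show ?thesis
    unfolding limit_set_eq[OF H]
    using boundary_class_eq_iff ray_converges[OF t one_closed] ray_converges[OF ti one_closed] by blast
qed

end

section \<open>From thin triangles to the four-point inequality\<close>

lemma geodesic_segmentE:
  assumes "geodesic_segment S d x y A" "q \<in> A" "Metric_space S d"
  shows "q \<in> S" "d x q + d q y = d x y"
proof -
  obtain c where c: "c ` {0..d x y} = A" "A \<subseteq> S" "c 0 = x" "c (d x y) = y"
    "\<forall>s\<in>{0..d x y}. \<forall>t\<in>{0..d x y}. d (c s) (c t) = \<bar>s - t\<bar>"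
    using assms(1) unfolding geodesic_segment_def by blast
  show "q \<in> S" using assms(2) c(2) by blast
  obtain s where s: "s \<in> {0..d x y}" "q = c s" using assms(2) c(1) by blast
  have "d (c 0) (c s) = s" "d (c s) (c (d x y)) = d x y - s"
    using c(5) s(1) by auto
  then show "d x q + d q y = d x y" using s(2) c(3,4) by simp
qed

lemma geodesic_segment_ends:
  assumes "geodesic_segment S d x y A" "Metric_space S d"
  shows "x \<in> A" "y \<in> A"
proof -
  obtain c where c: "c ` {0..d x y} = A" "c 0 = x" "c (d x y) = y"
    using assms(1) unfolding geodesic_segment_def by (elim exE conjE)
  have "c 0 \<in> A" "c (d x y) \<in> A"
    using Metric_space.nonneg[OF assms(2)] unfolding c(1)[symmetric] by auto
  then show "x \<in> A" "y \<in> A" by (simp_all add: c(2,3))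
qed

text \<open>Walking along \<open>A\<close> from \<open>x\<close>, the points pass from the
  neighborhood of \<open>C\<close> to that of \<open>B\<close>. A point at the transition is close
  to both sides, and then the lengths force its distance from \<open>w\<close> down to the Gromov
  product up to a constant.\<close>

lemma thin_triangle_gromov_product:
  assumes metric: "Metric_space S d" and w: "w \<in> S"
    and A: "geodesic_segment S d x y A" and B: "geodesic_segment S d y w B"
    and C: "geodesic_segment S d w x C"
    and thin: "A \<subseteq> nbhd S d \<delta> B \<union> nbhd S d \<delta> C" and "0 \<le> \<delta>"
  shows "\<exists>p\<in>A. d w p \<le> gromov_product d w x y + 2 * \<delta> + 1"
proof -
  interpret Metric_space S d by (rule metric)
  obtain c where c: "c ` {0..d x y} = A" "A \<subseteq> S" "c 0 = x" "c (d x y) = y"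
    "\<forall>s\<in>{0..d x y}. \<forall>t\<in>{0..d x y}. d (c s) (c t) = \<bar>s - t\<bar>"
    using A unfolding geodesic_segment_def by blast
  have xyS: "x \<in> S" "y \<in> S" using geodesic_segment_ends[OF A metric] c(2) by auto
  define T where "T = {s \<in> {0..d x y}. c s \<in> nbhd S d \<delta> C}"
  have "x \<in> nbhd S d \<delta> C"
    unfolding nbhd_def
    using geodesic_segment_ends(2)[OF C metric] xyS \<open>0 \<le> \<delta>\<close> by (auto intro!: bexI[of _ x])
  then have "0 \<in> T" using c(3) by (simp add: T_def)
  then have T: "T \<noteq> {}" by blast
  have bdd: "bdd_above T" by (auto simp: T_def intro!: bdd_aboveI[of _ "d x y"])
  \<comment> \<open>The supremum may not be attained, so \<open>s\<close> is taken within 1 of it.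
    Then \<open>s + 1\<close> is outside \<open>T\<close>, hence near \<open>B\<close>; if it
    overshoots the segment, the endpoint \<open>y\<close>, which is on \<open>B\<close>, is within
    1. This is the \<open>+ 1\<close> in the bound.\<close>
  obtain s where s: "s \<in> T" "Sup T - 1 < s"
    using less_cSupE[of "Sup T - 1" T] T by auto
  have sL: "0 \<le> s" "s \<le> d x y" using s(1) by (auto simp: T_def)
  obtain q where q: "q \<in> C" "d (c s) q \<le> \<delta>" using s(1) by (auto simp: T_def nbhd_def)
  have "\<exists>q'\<in>B. d (c s) q' \<le> \<delta> + 1"
  proof (cases "s + 1 \<le> d x y")
    case True
    have "s + 1 \<notin> T" using cSup_upper[OF _ bdd, of "s + 1"] s(2) by auto
    then have "c (s + 1) \<in> nbhd S d \<delta> B"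
      using subsetD[OF thin, of "c (s + 1)"] c(1) True sL by (auto simp: T_def)
    then obtain q' where q': "q' \<in> B" "d (c (s + 1)) q' \<le> \<delta>" by (auto simp: nbhd_def)
    have "d (c s) (c (s + 1)) = 1" using c(5) True sL by auto
    moreover have "c s \<in> S" "c (s + 1) \<in> S" using c(1,2) True sL by auto
    ultimately have "d (c s) q' \<le> \<delta> + 1"
      using triangle[of "c s" "c (s + 1)" q'] q' geodesic_segmentE(1)[OF B q'(1) metric] by simp
    then show ?thesis using q'(1) by blast
  next
    case False
    have "d (c s) (c (d x y)) = d x y - s" using c(5) sL by auto
    then have "d (c s) y = d x y - s" by (simp only: c(4))
    then have "d (c s) y \<le> \<delta> + 1" using False \<open>0 \<le> \<delta>\<close> by simp
    then show ?thesis using geodesic_segment_ends(1)[OF B metric] by blast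
  qed
  then obtain q' where q': "q' \<in> B" "d (c s) q' \<le> \<delta> + 1" by blast
  define p where "p = c s"
  have pA: "p \<in> A" using c(1) sL by (auto simp: p_def)
  note pp = geodesic_segmentE[OF A pA metric]
  note qq = geodesic_segmentE[OF C q(1) metric]
  note qq' = geodesic_segmentE[OF B q'(1) metric]
  have "d w p \<le> d w q + \<delta>" using triangle[of w q p] w pp(1) qq(1) q(2) commute[of p q] by (simp add: p_def)
  moreover have "d x p \<le> d q x + \<delta>"
    using triangle[of x q p] xyS pp(1) qq(1) q(2) commute[of p q] commute[of x q] by (simp add: p_def)
  moreover have "d w p \<le> d q' w + \<delta> + 1"
    using triangle[of w q' p] w pp(1) qq'(1) q'(2) commute[of p q'] commute[of w q'] by (simp add: p_def)
  moreover have "d p y \<le> d y q' + \<delta> + 1"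
    using triangle[of p q' y] xyS pp(1) qq'(1) q'(2) commute[of y q'] by (simp add: p_def)
  moreover have "2 * gromov_product d w x y = d w x + d y w - d x y"
    by (simp add: gromov_product_def commute[of w x])
  ultimately have "d w p \<le> gromov_product d w x y + 2 * \<delta> + 1"
    using pp(2) qq(2) qq'(2) by linarith
  then show ?thesis using pA by blast
qed

lemma gromov_product_le_segment:
  assumes metric: "Metric_space S d" and A: "geodesic_segment S d x y A"
    and w: "w \<in> S" and q: "q \<in> A"
  shows "gromov_product d w x y \<le> d w q"
proof -
  interpret Metric_space S d by (rule metric)
  have xy: "x \<in> S" "y \<in> S"
    using geodesic_segment_ends[OF A metric] geodesic_segmentE(1)[OF A _ metric] by blast+
  have "2 * gromov_product d w x y = d x w + d y w - d x y" by (simp add: gromov_product_def)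
  then show ?thesis
    using triangle[of x q w] triangle[of y q w] geodesic_segmentE[OF A q metric] xy w
      commute[of w q] commute[of y q] by simp
qed

text \<open>A point \<open>p\<close> on the side from \<open>z\<close> to \<open>x\<close> nearly
  realizes the product at \<open>w\<close>, with error \<open>2 * \<delta> + 1\<close>. Thinness of
  the triangle \<open>x\<close>, \<open>y\<close>, \<open>z\<close> gives \<open>q\<close> within
  \<open>\<delta>\<close> of \<open>p\<close> on another side, whose distance from \<open>w\<close>
  bounds the product of that side from above. Together this is
  \<open>3 * \<delta> + 1\<close>.\<close>

lemma hyperbolic_space_imp_four_point:
  assumes "hyperbolic_space S d"
  shows "\<exists>\<delta>. gromov_hyperbolic S d \<delta>"
proof -
  obtain \<delta> where \<delta>: "0 \<le> \<delta>" and geod: "geodesic_space S d"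
    and all: "\<forall>x\<in>S. \<forall>y\<in>S. \<forall>z\<in>S. \<forall>A B C.
        geodesic_segment S d x y A \<and> geodesic_segment S d y z B \<and> geodesic_segment S d z x C \<longrightarrow>
        A \<subseteq> nbhd S d \<delta> B \<union> nbhd S d \<delta> C \<and>
        B \<subseteq> nbhd S d \<delta> C \<union> nbhd S d \<delta> A \<and>
        C \<subseteq> nbhd S d \<delta> A \<union> nbhd S d \<delta> B"
    using assms unfolding hyperbolic_space_def by (elim exE conjE)
  have thin: "A \<subseteq> nbhd S d \<delta> B \<union> nbhd S d \<delta> C" "C \<subseteq> nbhd S d \<delta> A \<union> nbhd S d \<delta> B"
    if "x \<in> S" "y \<in> S" "z \<in> S" "geodesic_segment S d x y A"
      "geodesic_segment S d y z B" "geodesic_segment S d z x C" for x y z A B C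
    using all[rule_format, OF that(1-3), of A B C] that(4-6) by simp_all
  have metric: "Metric_space S d" and seg: "\<And>x y. \<lbrakk>x \<in> S; y \<in> S\<rbrakk> \<Longrightarrow> \<exists>A. geodesic_segment S d x y A"
    using geod by (auto simp: geodesic_space_def)
  interpret Metric_space S d by (rule metric)
  have "min (gromov_product d w x y) (gromov_product d w y z) - (3 * \<delta> + 1) \<le> gromov_product d w x z"
    if S: "w \<in> S" "x \<in> S" "y \<in> S" "z \<in> S" for w x y z
  proof -
    from seg[OF S(2,3)] seg[OF S(3,4)] seg[OF S(4,2)] obtain A B C where
      ABC: "geodesic_segment S d x y A" "geodesic_segment S d y z B" "geodesic_segment S d z x C"
      by (elim exE)
    from seg[OF S(2,1)] seg[OF S(1,4)] obtain B' C' where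
      BC': "geodesic_segment S d x w B'" "geodesic_segment S d w z C'"
      by (elim exE)
    from thin_triangle_gromov_product[OF metric S(1) ABC(3) BC' thin(1)[OF S(4,2,1) ABC(3) BC'] \<delta>]
    obtain p where p: "p \<in> C" "d w p \<le> gromov_product d w z x + 2 * \<delta> + 1"
      by (elim bexE)
    have pS: "p \<in> S" using geodesic_segmentE(1)[OF ABC(3) p(1) metric] .
    have "p \<in> nbhd S d \<delta> A \<union> nbhd S d \<delta> B" using thin(2)[OF S(2-4) ABC] p(1) by (rule subsetD)
    then obtain q where q: "q \<in> A \<or> q \<in> B" "d p q \<le> \<delta>" by (auto simp: nbhd_def)
    from q(1) have "q \<in> S \<and> min (gromov_product d w x y) (gromov_product d w y z) \<le> d w q"
    proof
      assume "q \<in> A"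
      then show ?thesis
        using geodesic_segmentE(1)[OF ABC(1) _ metric] gromov_product_le_segment[OF metric ABC(1) S(1)]
        by (simp add: min.coboundedI1)
    next
      assume "q \<in> B"
      then show ?thesis
        using geodesic_segmentE(1)[OF ABC(2) _ metric] gromov_product_le_segment[OF metric ABC(2) S(1)]
        by (simp add: min.coboundedI2)
    qed
    then have qS: "q \<in> S" and "min (gromov_product d w x y) (gromov_product d w y z) \<le> d w q"
      by simp_all
    moreover have "d w q \<le> d w p + \<delta>" using triangle[of w p q] S(1) pS qS q(2) by simp
    moreover have "gromov_product d w z x = gromov_product d w x z"
      by (simp add: gromov_product_def commute[of z x])
    ultimately show ?thesis using p(2) by linarith
  qed
  then have "gromov_hyperbolic S d (3 * \<delta> + 1)"
    using \<delta> by unfold_locales (auto simp: commute triangle)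
  then show ?thesis ..
qed

section \<open>Passage from the defined notions to the locale, and restriction to subgroups\<close>

lemma acylindrical_hyperbolic_action_exists:
  fixes G (structure)
  assumes hyp: "hyperbolic_space S d" and act: "acylindrical_action G S d \<phi>" and x0: "x0 \<in> S"
  shows "\<exists>\<delta>. acylindrical_hyperbolic_action G S d \<delta> \<phi> x0"
proof -
  obtain \<delta> where "gromov_hyperbolic S d \<delta>" using hyperbolic_space_imp_four_point[OF hyp] by blast
  then interpret gromov_hyperbolic S d \<delta> .
  have ga: "group_action G S \<phi>" and iso: "\<And>g x y. \<lbrakk>g \<in> carrier G; x \<in> S; y \<in> S\<rbrakk> \<Longrightarrow> d (\<phi> g x) (\<phi> g y) = d x y"
    using act by (auto simp: acylindrical_action_def isometric_action_def)
  interpret group_action G S \<phi> by (rule ga)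
  interpret group_hom G "BijGroup S" \<phi> by (rule group_hom)
  have "acylindrical_hyperbolic_action G S d \<delta> \<phi> x0"
  proof unfold_locales
    show "\<exists>z\<in>S. d x z = s \<and> d z y = d x y - s" if xy: "x \<in> S" "y \<in> S" and s: "0 \<le> s" "s \<le> d x y" for x y s
    proof -
      obtain A where "geodesic_segment S d x y A"
        using hyp xy unfolding hyperbolic_space_def geodesic_space_def by blast
      then obtain c where c: "c ` {0..d x y} \<subseteq> S" "c 0 = x" "c (d x y) = y"
        "\<forall>s\<in>{0..d x y}. \<forall>t\<in>{0..d x y}. d (c s) (c t) = \<bar>s - t\<bar>"
        unfolding geodesic_segment_def by blast
      have "d (c 0) (c s) = s" "d (c s) (c (d x y)) = d x y - s" using c(4) s by auto
      then show ?thesis using c(1-3) s by (intro bexI[of _ "c s"]) auto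
    qed
    show "\<phi> \<one> x = x" if "x \<in> S" for x using id_eq_one that by (metis restrict_apply')
    show "\<exists>R. \<exists>N::nat. \<forall>x\<in>S. \<forall>y\<in>S. R \<le> d x y \<longrightarrow>
      finite {g \<in> carrier G. d x (\<phi> g x) \<le> \<epsilon> \<and> d y (\<phi> g y) \<le> \<epsilon>} \<and>
      card {g \<in> carrier G. d x (\<phi> g x) \<le> \<epsilon> \<and> d y (\<phi> g y) \<le> \<epsilon>} \<le> N" if "0 < \<epsilon>" for \<epsilon>
    proof -
      have "\<exists>R>0. \<exists>N::nat. N > 0 \<and> (\<forall>x\<in>S. \<forall>y\<in>S. d x y \<ge> R \<longrightarrow>
          finite {g \<in> carrier G. d x (\<phi> g x) \<le> \<epsilon> \<and> d y (\<phi> g y) \<le> \<epsilon>} \<and>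
          card {g \<in> carrier G. d x (\<phi> g x) \<le> \<epsilon> \<and> d y (\<phi> g y) \<le> \<epsilon>} \<le> N)"
        using act that by (simp add: acylindrical_action_def)
      then show ?thesis by (elim exE conjE) (intro exI)
    qed
  qed (use x0 iso element_image composition_rule in auto)
  then show ?thesis ..
qed

lemma acylindrical_action_subgroup:
  assumes act: "acylindrical_action G S d \<phi>" and H: "subgroup H G"
  shows "acylindrical_action (G\<lparr>carrier := H\<rparr>) S d \<phi>"
proof -
  have ga: "group_action G S \<phi>" and metric: "Metric_space S d"
    using act by (auto simp: acylindrical_action_def isometric_action_def)
  interpret group_action G S \<phi> by (rule ga)
  interpret group_hom G "BijGroup S" \<phi> by (rule group_hom)
  have Hc: "h \<in> carrier G" if "h \<in> H" for h using subgroup.mem_carrier[OF H that] .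
  have "group_hom (G\<lparr>carrier := H\<rparr>) (BijGroup S) \<phi>"
    using subgroup.subgroup_is_group[OF H G.group_axioms] H.group_axioms Hc
    by (intro group_hom.intro group_hom_axioms.intro homI) auto
  then have "isometric_action (G\<lparr>carrier := H\<rparr>) S d \<phi>"
    using act Hc metric
    by (auto simp: acylindrical_action_def isometric_action_def group_action_def)
  moreover have "\<exists>R>0. \<exists>N::nat. N > 0 \<and> (\<forall>x\<in>S. \<forall>y\<in>S. d x y \<ge> R \<longrightarrow>
      finite {g \<in> H. d x (\<phi> g x) \<le> \<epsilon> \<and> d y (\<phi> g y) \<le> \<epsilon>} \<and>
      card {g \<in> H. d x (\<phi> g x) \<le> \<epsilon> \<and> d y (\<phi> g y) \<le> \<epsilon>} \<le> N)" if "0 < \<epsilon>" for \<epsilon>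
  proof -
    have "\<exists>R>0. \<exists>N::nat. N > 0 \<and> (\<forall>x\<in>S. \<forall>y\<in>S. d x y \<ge> R \<longrightarrow>
        finite {g \<in> carrier G. d x (\<phi> g x) \<le> \<epsilon> \<and> d y (\<phi> g y) \<le> \<epsilon>} \<and>
        card {g \<in> carrier G. d x (\<phi> g x) \<le> \<epsilon> \<and> d y (\<phi> g y) \<le> \<epsilon>} \<le> N)"
      using act \<open>0 < \<epsilon>\<close> by (simp add: acylindrical_action_def)
    then obtain R and N :: nat where RN: "R > 0" "N > 0" "\<forall>x\<in>S. \<forall>y\<in>S. d x y \<ge> R \<longrightarrow>
        finite {g \<in> carrier G. d x (\<phi> g x) \<le> \<epsilon> \<and> d y (\<phi> g y) \<le> \<epsilon>} \<and>
        card {g \<in> carrier G. d x (\<phi> g x) \<le> \<epsilon> \<and> d y (\<phi> g y) \<le> \<epsilon>} \<le> N"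
      by (elim exE conjE)
    have "finite {g \<in> H. d x (\<phi> g x) \<le> \<epsilon> \<and> d y (\<phi> g y) \<le> \<epsilon>} \<and>
        card {g \<in> H. d x (\<phi> g x) \<le> \<epsilon> \<and> d y (\<phi> g y) \<le> \<epsilon>} \<le> N"
      if "x \<in> S" "y \<in> S" "d x y \<ge> R" for x y
    proof -
      have sub: "{g \<in> H. d x (\<phi> g x) \<le> \<epsilon> \<and> d y (\<phi> g y) \<le> \<epsilon>} \<subseteq>
          {g \<in> carrier G. d x (\<phi> g x) \<le> \<epsilon> \<and> d y (\<phi> g y) \<le> \<epsilon>}" using Hc by auto
      from RN(3) that have fin: "finite {g \<in> carrier G. d x (\<phi> g x) \<le> \<epsilon> \<and> d y (\<phi> g y) \<le> \<epsilon>}"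
        and card: "card {g \<in> carrier G. d x (\<phi> g x) \<le> \<epsilon> \<and> d y (\<phi> g y) \<le> \<epsilon>} \<le> N" by simp_all
      show ?thesis using finite_subset[OF sub fin] card_mono[OF fin sub] card by simp
    qed
    then show ?thesis
      by (intro exI[of _ R] exI[of _ N] conjI ballI impI) (simp_all add: RN(1,2))
  qed
  ultimately show ?thesis by (simp add: acylindrical_action_def)
qed

section \<open>Products of elementary subgroups\<close>

theorem (in acylindrical_hyperbolic_action) elementary_if_product:
  assumes "1 \<le> n" and H: "\<And>i. i < n \<Longrightarrow> subgroup (H i) G"
    and elem: "\<And>i. i < n \<Longrightarrow> elementary_action (G\<lparr>carrier := H i\<rparr>) S d \<phi>"
    and prod: "\<And>x. x \<in> carrier G \<Longrightarrow>
      \<exists>p. p 0 = \<one> \<and> (\<forall>i<n. \<exists>h\<in>H i. p (Suc i) = p i \<otimes> h) \<and> p n = x"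
  shows "elementary_action G S d \<phi>"
proof (rule ccontr)
  assume nonelem: "\<not> elementary_action G S d \<phi>"
  have G_eq: "G\<lparr>carrier := carrier G\<rparr> = G" by simp
  have "\<exists>h\<in>carrier G. B < d x0 (\<phi> h x0)" for B
  proof (rule ccontr)
    assume "\<not> ?thesis"
    then have "limit_set G S d \<phi> = {}"
      using limit_set_empty_if_bounded[of "carrier G" B] by (simp add: not_less)
    with nonelem show False by (simp add: elementary_action_def)
  qed
  from loxodromic_if_unbounded[OF subgroup_self this]
  obtain t C where t: "t \<in> carrier G" "orb.loxodromic C t" by (elim bexE exE)
  \<comment> \<open>If every \<open>g\<close> commensurated the powers of \<open>t\<close>, the
    whole orbit would stay near one axis, with a bound independent of \<open>g\<close>, and the
    limit set would consist of at most two ends.\<close>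
  have "\<exists>g\<in>carrier G. \<forall>(p::int) (q::int). p \<noteq> 0 \<longrightarrow> t [^] p \<noteq> g \<otimes> t [^] q \<otimes> inv g"
  proof (rule ccontr)
    assume contra: "\<not> ?thesis"
    have "\<exists>l::int. d (\<phi> g x0) (\<phi> (t [^] l) x0) \<le> orb.len t + 4 * C + 6 * \<delta>" if "g \<in> carrier G" for g
    proof -
      obtain p q :: int where "p \<noteq> 0" "t [^] p = g \<otimes> t [^] q \<otimes> inv g"
        using contra \<open>g \<in> carrier G\<close> by auto
      then show ?thesis by (rule orb.near_axis_of_commensurating[OF t(2) that])
    qed
    from limit_set_small_if_near_axis[OF subset_refl t(2) this]
    have "limit_set G S d \<phi> \<subseteq> {joint_rel `` {ray \<one> t}, joint_rel `` {ray \<one> (inv t)}}"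
      unfolding G_eq .
    moreover have "card {joint_rel `` {ray \<one> t}, joint_rel `` {ray \<one> (inv t)}} \<le> 2"
      by (simp add: card_insert_if)
    ultimately have "finite (limit_set G S d \<phi>)" "card (limit_set G S d \<phi>) \<le> 2"
      using finite_subset[of "limit_set G S d \<phi>" "{joint_rel `` {ray \<one> t}, joint_rel `` {ray \<one> (inv t)}}"]
        card_mono[of "{joint_rel `` {ray \<one> t}, joint_rel `` {ray \<one> (inv t)}}" "limit_set G S d \<phi>"]
      by simp_all
    then have "elementary_action G S d \<phi>" by (simp add: elementary_action_def)
    with nonelem show False ..
  qed
  then obtain g where g: "g \<in> carrier G" "\<And>(p::int) (q::int). p \<noteq> 0 \<Longrightarrow> t [^] p \<noteq> g \<otimes> t [^] q \<otimes> inv g"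
    by blast
  have small: "(\<exists>B. \<forall>h\<in>H i. orb.len h \<le> B) \<or>
      (\<exists>C s D. orb.loxodromic C s \<and> (\<forall>h\<in>H i. \<exists>j::int. d (\<phi> h x0) (\<phi> (s [^] j) x0) \<le> D))"
    if i: "i < n" for i
  proof (cases "\<exists>B. \<forall>h\<in>H i. orb.len h \<le> B")
    case False
    then have "\<exists>h\<in>H i. B < d x0 (\<phi> h x0)" for B by (auto simp: len_eq not_le)
    from loxodromic_if_unbounded[OF H[OF i] this]
    obtain s C where s: "s \<in> H i" "orb.loxodromic C s" by (elim bexE exE)
    have lim: "finite (limit_set (G\<lparr>carrier := H i\<rparr>) S d \<phi>)"
      "card (limit_set (G\<lparr>carrier := H i\<rparr>) S d \<phi>) \<le> 2"
      using elem[OF i] by (simp_all add: elementary_action_def)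
    have "\<forall>h\<in>H i. \<exists>j::int. d (\<phi> h x0) (\<phi> (s [^] j) x0) \<le> orb.len s + 4 * C + 6 * \<delta>"
      using near_axis_if_limit_set_small[OF H[OF i] s(2,1) lim] by (rule ballI)
    with s(2) have "orb.loxodromic C s \<and>
        (\<forall>h\<in>H i. \<exists>j::int. d (\<phi> h x0) (\<phi> (s [^] j) x0) \<le> orb.len s + 4 * C + 6 * \<delta>)" ..
    then show ?thesis by (intro disjI2 exI)
  qed (rule disjI1)
  have Hc: "H i \<subseteq> carrier G" if "i < n" for i using H[OF that] by (rule subgroup.subset)
  have "\<exists>x\<in>carrier G. \<forall>p. p 0 = \<one> \<longrightarrow> (\<forall>i<n. \<exists>h\<in>H i. p (Suc i) = p i \<otimes> h) \<longrightarrow> p n \<noteq> x"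
    by (rule orb.not_bounded_product[OF t(2) g(1)])
      (erule g(2), rule \<open>1 \<le> n\<close>, erule Hc, erule small)
  then obtain x where x: "x \<in> carrier G"
    "\<forall>p. p 0 = \<one> \<longrightarrow> (\<forall>i<n. \<exists>h\<in>H i. p (Suc i) = p i \<otimes> h) \<longrightarrow> p n \<noteq> x"
    by (elim bexE)
  from prod[OF x(1)] obtain p where
    "p 0 = \<one>" "\<forall>i<n. \<exists>h\<in>H i. p (Suc i) = p i \<otimes> h" "p n = x"
    by (elim exE conjE)
  with x(2) show False by simp
qed

lemma (in monoid) foldr_mult_snoc:
  "\<lbrakk>set xs \<subseteq> carrier G; x \<in> carrier G\<rbrakk> \<Longrightarrow>
    foldr (\<otimes>) (xs @ [x]) \<one> = foldr (\<otimes>) xs \<one> \<otimes> x \<and> foldr (\<otimes>) xs \<one> \<in> carrier G"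
  by (induction xs) (auto simp: m_assoc)

theorem proposition1p7:
  fixes G :: "('a, 'm) monoid_scheme" (structure)
    and H :: "nat \<Rightarrow> 'a set" and n :: nat
  assumes "group G"
    and "acylindrically_hyperbolic TYPE('s) G"
    and "n \<ge> 1"
    and "\<And>i. i \<in> {1..n} \<Longrightarrow> subgroup (H i) G"
    and "\<And>g. g \<in> carrier G \<Longrightarrow>
           \<exists>h. (\<forall>i\<in>{1..n}. h i \<in> H i) \<and> g = foldr (\<otimes>) (map h [1..<Suc n]) \<one>"
  shows "\<exists>i\<in>{1..n}. acylindrically_hyperbolic TYPE('s) (G\<lparr>carrier := H i\<rparr>)"
proof (rule ccontr)
  assume none: "\<not> ?thesis"
  obtain S :: "'s set" and d \<phi> where act: "hyperbolic_space S d" "acylindrical_action G S d \<phi>"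
    and nonelem: "\<not> elementary_action G S d \<phi>"
    using assms(2) unfolding acylindrically_hyperbolic_def by blast
  have "limit_set G S d \<phi> \<noteq> {}" using nonelem by (auto simp: elementary_action_def)
  then obtain x0 where "x0 \<in> S" by (auto simp: limit_set_def)
  then obtain \<delta> where "acylindrical_hyperbolic_action G S d \<delta> \<phi> x0"
    using acylindrical_hyperbolic_action_exists[OF act] by blast
  then interpret acylindrical_hyperbolic_action G S d \<delta> \<phi> x0 .
  have H: "subgroup (H (Suc i)) G" if "i < n" for i using that assms(4) by simp
  \<comment> \<open>Each subgroup is tested on the same space \<open>S\<close>, so the universe
    \<open>'s\<close> stays the same. The shift by \<open>Suc\<close> matches factors numbered from
    1 with paths whose sides are numbered from 0.\<close>
  have "elementary_action (G\<lparr>carrier := H (Suc i)\<rparr>) S d \<phi>" if "i < n" for i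
    using none act(1) acylindrical_action_subgroup[OF act(2) H[OF that]] that
    unfolding acylindrically_hyperbolic_def by force
  moreover have "\<exists>p. p 0 = \<one> \<and> (\<forall>i<n. \<exists>h\<in>H (Suc i). p (Suc i) = p i \<otimes> h) \<and> p n = x"
    if x: "x \<in> carrier G" for x
  proof -
    obtain h where h: "\<And>i. i \<in> {1..n} \<Longrightarrow> h i \<in> H i" "x = foldr (\<otimes>) (map h [1..<Suc n]) \<one>"
      using assms(5)[OF x] by blast
    have hc: "h i \<in> carrier G" if "i \<in> {1..n}" for i
      using subgroup.mem_carrier[OF assms(4)[OF that] h(1)[OF that]] .
    define p where "p i = foldr (\<otimes>) (map h [1..<Suc i]) \<one>" for i
    have "p (Suc i) = p i \<otimes> h (Suc i)" if "i < n" for i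
    proof -
      have "set (map h [1..<Suc i]) \<subseteq> carrier G" "h (Suc i) \<in> carrier G" using hc that by auto
      from foldr_mult_snoc[OF this] show ?thesis
        unfolding p_def by (subst upt_Suc_append) simp_all
    qed
    moreover have "h (Suc i) \<in> H (Suc i)" if "i < n" for i using h(1)[of "Suc i"] that by simp
    ultimately have "p 0 = \<one> \<and> (\<forall>i<n. \<exists>h\<in>H (Suc i). p (Suc i) = p i \<otimes> h) \<and> p n = x"
      using h(2) unfolding p_def by auto
    then show ?thesis by blast
  qed
  ultimately have "elementary_action G S d \<phi>"
    using elementary_if_product[of n "\<lambda>i. H (Suc i)"] \<open>n \<ge> 1\<close> H by blast
  with nonelem show False ..
qed

end
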